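(* The Unambiguisability problem for $(\min,+)$ weighted finite automata is reducible to the Determinisability problem for $(\min,+)$ weighted finite automata. That is, there is a computable function mapping each WFA $\mathcal{A}$ to a WFA $\mathcal{B}$ such that $\mathcal{A}$ is unambiguisable if and only if $\mathcal{B}$ is determinisable.
   Context: Write $\mathbb{Z}_\infty=\mathbb{Z}\cup\{\infty\}$. A WFA is a tuple $\mathcal{A}=\langle Q,\Sigma,q_0,\Delta,F\rangle$ with $Q$ a finite set of states, $\Sigma$ a finite alphabet, $q_0\in Q$ the initial state, $F\subseteq Q$ the accepting states, and $\Delta\subseteq Q\times\Sigma\times\mathbb{Z}_\infty\times Q$ a transition relation such that for every $p,q\in Q$, $\sigma\in\Sigma$ there is exactly one $c\in\mathbb{Z}_\infty$ with $(p,\sigma,c,q)\in\Delta$ (weight $\infty$ means the transition is absent). A run on a word is a sequence of consecutive transitions of finite weight reading the word; its weight is the sum of its transition weights. A run is accepting if it starts in $q_0$ and ends in $F$. $\mathcal{A}(w)\in\mathbb{Z}_\infty$ is the minimal weight of an accepting run on $w$ ($\infty$ if none). Two WFAs are equivalent if they define the same function $\Sigma^*\to\mathbb{Z}_\infty$. A WFA is deterministic if for every $p\in Q,\sigma\in\Sigma$ there is at most one transition $(p,\sigma,c,q)\in\Delta$ with $c\neq\infty$; it is unambiguous if every word has at most one accepting run. A WFA is determinisable (resp. unambiguisable) if it is equivalent to some deterministic (resp. unambiguous) WFA. The Determinisability (resp. Unambiguisability) problem is: given a WFA, decide whether it is determinisable (resp. unambiguisable). *)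

theory Defs
  imports "HOL-Library.Nat_Bijection"
begin

section \<open>Min-plus weighted finite automata\<close>

text \<open>The weights, i.e. the integers extended by a single infinite element.\<close>

datatype zinf = Fin (int_of: int) | Infty

type_synonym ('q, 'a) transition = "'q \<times> 'a \<times> zinf \<times> 'q"

record ('q, 'a) wfa =
  states :: "'q set"
  alphabet :: "'a set"
  init :: 'q
  delta :: "('q, 'a) transition set"
  final :: "'q set"

definition is_wfa :: "('q, 'a) wfa \<Rightarrow> bool" where
  "is_wfa A \<longleftrightarrow>
     finite (states A) \<and> finite (alphabet A) \<and>
     init A \<in> states A \<and> final A \<subseteq> states A \<and>
     delta A \<subseteq> states A \<times> alphabet A \<times> UNIV \<times> states A \<and>
     (\<forall>p\<in>states A. \<forall>q\<in>states A. \<forall>a\<in>alphabet A. \<exists>!c. (p, a, c, q) \<in> delta A)"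

text \<open>
  \<open>is_run A p w \<rho> q\<close>: the transition sequence \<open>\<rho>\<close> is a run on \<open>w\<close> from \<open>p\<close> to \<open>q\<close>. The endpoints
  are explicit because the empty sequence does not determine them.
\<close>

fun is_run :: "('q, 'a) wfa \<Rightarrow> 'q \<Rightarrow> 'a list \<Rightarrow> ('q, 'a) transition list \<Rightarrow> 'q \<Rightarrow> bool" where
  "is_run A p [] [] q \<longleftrightarrow> p = q"
| "is_run A p (a # w) ((p', a', c, r) # \<rho>) q \<longleftrightarrow>
     p' = p \<and> a' = a \<and> c \<noteq> Infty \<and> (p', a', c, r) \<in> delta A \<and> is_run A r w \<rho> q"
| "is_run A p [] (t # \<rho>) q \<longleftrightarrow> False"
| "is_run A p (a # w) [] q \<longleftrightarrow> False"

definition run_weight :: "('q, 'a) transition list \<Rightarrow> int" where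
  "run_weight \<rho> = (\<Sum>(p, a, c, q)\<leftarrow>\<rho>. int_of c)"

definition accepting_run :: "('q, 'a) wfa \<Rightarrow> 'a list \<Rightarrow> ('q, 'a) transition list \<Rightarrow> bool" where
  "accepting_run A w \<rho> \<longleftrightarrow> (\<exists>q\<in>final A. is_run A (init A) w \<rho> q)"

text \<open>\<open>Min\<close> is only meaningful on finite sets; see \<open>finite_accepting_runs\<close> below.\<close>

definition wfa_value :: "('q, 'a) wfa \<Rightarrow> 'a list \<Rightarrow> zinf" where
  "wfa_value A w =
     (if \<exists>\<rho>. accepting_run A w \<rho> then Fin (Min {run_weight \<rho> |\<rho>. accepting_run A w \<rho>}) else Infty)"

definition equivalent :: "('q, 'a) wfa \<Rightarrow> ('r, 'a) wfa \<Rightarrow> bool" where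
  "equivalent A B \<longleftrightarrow>
     alphabet A = alphabet B \<and> (\<forall>w\<in>lists (alphabet A). wfa_value A w = wfa_value B w)"

definition deterministic :: "('q, 'a) wfa \<Rightarrow> bool" where
  "deterministic A \<longleftrightarrow>
     (\<forall>p\<in>states A. \<forall>a\<in>alphabet A.
        \<exists>\<^sub>\<le>\<^sub>1t. t \<in> delta A \<and> (\<exists>c q. t = (p, a, c, q) \<and> c \<noteq> Infty))"

definition unambiguous :: "('q, 'a) wfa \<Rightarrow> bool" where
  "unambiguous A \<longleftrightarrow> (\<forall>w\<in>lists (alphabet A). \<exists>\<^sub>\<le>\<^sub>1\<rho>. accepting_run A w \<rho>)"

text \<open>
  The witnesses range over automata whose states are natural numbers. This is no restriction,
  since any finite state set can be renamed injectively into the naturals.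
\<close>

definition determinisable :: "('q, 'a) wfa \<Rightarrow> bool" where
  "determinisable A \<longleftrightarrow> (\<exists>D :: (nat, 'a) wfa. is_wfa D \<and> deterministic D \<and> equivalent A D)"

definition unambiguisable :: "('q, 'a) wfa \<Rightarrow> bool" where
  "unambiguisable A \<longleftrightarrow> (\<exists>U :: (nat, 'a) wfa. is_wfa U \<and> unambiguous U \<and> equivalent A U)"

lemma is_run_length: "is_run A p w \<rho> q \<Longrightarrow> length \<rho> = length w"
  by (induction A p w \<rho> q rule: is_run.induct) auto

lemma is_run_set: "is_run A p w \<rho> q \<Longrightarrow> set \<rho> \<subseteq> delta A"
  by (induction A p w \<rho> q rule: is_run.induct) auto

lemma finite_delta:
  assumes "is_wfa A"
  shows "finite (delta A)"
proof -
  let ?S = "states A \<times> alphabet A \<times> states A"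
  let ?f = "\<lambda>(p, a, q). (p, a, THE c. (p, a, c, q) \<in> delta A, q)"
  have "delta A \<subseteq> ?f ` ?S"
  proof
    fix t assume t: "t \<in> delta A"
    obtain p a c q where [simp]: "t = (p, a, c, q)" by (cases t)
    have S: "(p, a, q) \<in> ?S" using t assms by (auto simp: is_wfa_def)
    then have "\<exists>!c. (p, a, c, q) \<in> delta A" using assms by (auto simp: is_wfa_def)
    then have "(THE c. (p, a, c, q) \<in> delta A) = c"
      by (rule the1_equality) (use t in simp)
    then have "t = ?f (p, a, q)" by simp
    then show "t \<in> ?f ` ?S" using S by (rule image_eqI)
  qed
  moreover have "finite ?S" using assms by (simp add: is_wfa_def)
  ultimately show ?thesis by (meson finite_imageI finite_subset)
qed

lemma finite_accepting_runs:
  assumes "is_wfa A"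
  shows "finite {\<rho>. accepting_run A w \<rho>}"
proof (rule finite_subset)
  show "{\<rho>. accepting_run A w \<rho>} \<subseteq> {\<rho>. set \<rho> \<subseteq> delta A \<and> length \<rho> = length w}"
    using is_run_length is_run_set by (fastforce simp: accepting_run_def)
  show "finite {\<rho>. set \<rho> \<subseteq> delta A \<and> length \<rho> = length w}"
    by (rule finite_lists_length_eq[OF finite_delta[OF assms]])
qed


section \<open>Computable functions\<close>

text \<open>
  The general recursive functions: the closure of the initial functions under composition,
  primitive recursion and minimisation of regular functions. \<open>recursive n f\<close> is meant for
  \<open>f\<close> restricted to lists of length \<open>n\<close>, its argument tuples; the values of \<open>f\<close> on other lists are
  irrelevant and never influence its values on lists of length \<open>n\<close>.
\<close>

inductive recursive :: "nat \<Rightarrow> (nat list \<Rightarrow> nat) \<Rightarrow> bool" where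
  zero: "recursive n (\<lambda>xs. 0)"
| succ: "recursive 1 (\<lambda>xs. Suc (xs ! 0))"
| proj: "i < n \<Longrightarrow> recursive n (\<lambda>xs. xs ! i)"
| comp: "recursive (length gs) f \<Longrightarrow> (\<And>g. g \<in> set gs \<Longrightarrow> recursive n g) \<Longrightarrow>
    recursive n (\<lambda>xs. f (map (\<lambda>g. g xs) gs))"
| prec: "recursive n f \<Longrightarrow> recursive (n + 2) g \<Longrightarrow>
    recursive (n + 1) (\<lambda>xs. rec_nat (f (tl xs)) (\<lambda>k r. g (k # r # tl xs)) (hd xs))"
| minim: "recursive (n + 1) f \<Longrightarrow> (\<And>xs. length xs = n \<Longrightarrow> \<exists>y. f (y # xs) = 0) \<Longrightarrow>
    recursive n (\<lambda>xs. LEAST y. f (y # xs) = 0)"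

definition computable :: "(nat \<Rightarrow> nat) \<Rightarrow> bool" where
  "computable h \<longleftrightarrow> (\<exists>f. recursive 1 f \<and> (\<forall>x. h x = f [x]))"

text \<open>
  As inputs and outputs of algorithms, automata have natural numbers as states and letters, and are
  coded by numbers. Here \<open>set_encode S\<close> is the number whose binary digits list the elements of the
  finite set \<open>S\<close>.
\<close>

fun zinf_encode :: "zinf \<Rightarrow> nat" where
  "zinf_encode Infty = 0"
| "zinf_encode (Fin k) = Suc (int_encode k)"

fun transition_encode :: "(nat, nat) transition \<Rightarrow> nat" where
  "transition_encode (p, a, c, q) =
     prod_encode (p, prod_encode (a, prod_encode (zinf_encode c, q)))"

definition wfa_encode :: "(nat, nat) wfa \<Rightarrow> nat" where
  "wfa_encode A =
     prod_encode (set_encode (states A),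
       prod_encode (set_encode (alphabet A),
         prod_encode (init A,
           prod_encode (set_encode (transition_encode ` delta A), set_encode (final A)))))"

definition wfa_computable :: "((nat, nat) wfa \<Rightarrow> (nat, nat) wfa) \<Rightarrow> bool" where
  "wfa_computable f \<longleftrightarrow>
     (\<exists>h. computable h \<and> (\<forall>A. is_wfa A \<longrightarrow> h (wfa_encode A) = wfa_encode (f A)))"

lemma zinf_encode_eq_iff: "zinf_encode c = zinf_encode d \<longleftrightarrow> c = d"
  by (cases c; cases d) (auto simp: int_encode_eq)

lemma inj_transition_encode: "inj transition_encode"
  by (auto simp: inj_def prod_encode_eq zinf_encode_eq_iff)

lemma inj_on_wfa_encode: "inj_on wfa_encode {A. is_wfa A}"
proof (rule inj_onI, clarify)
  fix A B assume A: "is_wfa A" and B: "is_wfa B" and eq: "wfa_encode A = wfa_encode B"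
  have fin: "finite (states C)" "finite (alphabet C)" "finite (final C)"
      "finite (transition_encode ` delta C)" if "is_wfa C" for C :: "(nat, nat) wfa"
    using that finite_delta[OF that] by (auto simp: is_wfa_def intro: finite_subset)
  have "transition_encode ` delta A = transition_encode ` delta B"
      "states A = states B" "alphabet A = alphabet B" "init A = init B" "final A = final B"
    using eq fin[OF A] fin[OF B] by (simp_all add: wfa_encode_def prod_encode_eq set_encode_eq)
  then show "A = B"
    by (simp add: inj_image_eq_iff[OF inj_transition_encode] wfa.equality)
qed

end

theory Submission
  imports Defs
begin

text \<open>
  Given \<open>A\<close>, let \<open>B\<close> read words of \<open>A\<close> in which every letter is accompanied by the set of states
  from which \<open>A\<close> accepts the remaining word, and reject all incorrectly annotated words. Since the
  annotation is determined from the right, guessing it turns a deterministic automaton for \<open>B\<close> into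
  an unambiguous one for \<open>A\<close>.

  Conversely, let \<open>U\<close> be unambiguous and equivalent to \<open>A\<close>. If \<open>A\<close> accepts \<open>w\<close> and \<open>w'\<close> from the
  same states, then the values of \<open>A\<close> on \<open>v w\<close> and \<open>v w'\<close> differ by at most a constant depending only on \<open>w\<close>
  and \<open>w'\<close>. Hence the weights with which \<open>U\<close> reaches, on a prefix \<open>v\<close>, the states that are still
  useful for a fixed annotation of the remaining word have bounded differences. So \<open>B\<close> has
  finitely many residuals up to additive shifts, and it is determinisable by a Myhill--Nerode
  construction.
\<close>

section \<open>Closure properties of the recursive functions\<close>

text \<open>Why announcements help: an unambiguous automaton may keep two counters, one for words
  ending in \<open>a\<close> and one for words ending in \<open>b\<close>. Their difference is
  unbounded, so no deterministic automaton can follow both. Once the set \<open>S\<close> of states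
  of \<open>A\<close> accepting the rest is announced, every state \<open>q\<close> of
  \<open>U\<close> that is still useful has a fixed witness suffix \<open>W q\<close> with exactly
  this set. By unambiguity the value on \<open>v @ W q\<close> equals the weight of reaching
  \<open>q\<close> on \<open>v\<close> plus a constant \<open>K q\<close>; there is no cheaper run
  that could hide it. A bound on the change of value between two witness suffixes is therefore a
  bound on the difference of the two weights.

  In the other direction, the guessing automaton has to satisfy the rule of one weight per pair of
  states and letter, so its states record which annotated letter was guessed.

  Computability rests on one fact: all states, letters, weights and transitions occurring in an
  automaton have codes bounded by the code of the automaton. Every set of the new automaton is then
  a bounded comprehension over numbers.\<close>

definition recursive_on :: "nat \<Rightarrow> (nat list \<Rightarrow> nat) \<Rightarrow> bool" where
  "recursive_on n f \<longleftrightarrow> (\<exists>f'. recursive n f' \<and> (\<forall>xs. length xs = n \<longrightarrow> f xs = f' xs))"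

definition computable2 :: "(nat \<Rightarrow> nat \<Rightarrow> nat) \<Rightarrow> bool" where
  "computable2 h \<longleftrightarrow> recursive_on 2 (\<lambda>xs. h (xs ! 0) (xs ! 1))"

text \<open>\<open>recursive\<close> speaks about one particular function on all lists, including
  those of the wrong length. \<open>recursive_on\<close> ignores its values there, so that arguments
  can be written as \<open>xs ! 0\<close>, \<open>xs ! 1\<close>.\<close>

lemma computable_iff_recursive_on: "computable h \<longleftrightarrow> recursive_on 1 (\<lambda>xs. h (xs ! 0))"
  unfolding computable_def recursive_on_def
  by (rule ex_cong1) (auto simp: length_Suc_conv)

lemma recursive_on_proj: "i < n \<Longrightarrow> recursive_on n (\<lambda>xs. xs ! i)"
  unfolding recursive_on_def using recursive.proj by blast

lemma recursive_on_comp1: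
  assumes "computable h" "recursive_on n f"
  shows "recursive_on n (\<lambda>xs. h (f xs))"
proof -
  obtain h' where h: "recursive 1 h'" "\<And>x. h x = h' [x]"
    using assms(1) by (auto simp: computable_def)
  obtain f' where f: "recursive n f'" "\<And>xs. length xs = n \<Longrightarrow> f xs = f' xs"
    using assms(2) by (auto simp: recursive_on_def)
  have "recursive n (\<lambda>xs. h' (map (\<lambda>g. g xs) [f']))"
    by (rule recursive.comp) (use h(1) f(1) in auto)
  then show ?thesis unfolding recursive_on_def using h(2) f(2) by auto
qed

lemma recursive_on_comp2:
  assumes "computable2 h" "recursive_on n f" "recursive_on n g"
  shows "recursive_on n (\<lambda>xs. h (f xs) (g xs))"
proof -
  obtain h' where h: "recursive 2 h'" "\<And>xs. length xs = 2 \<Longrightarrow> h (xs ! 0) (xs ! 1) = h' xs"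
    using assms(1) by (auto simp: computable2_def recursive_on_def)
  have h2: "h x y = h' [x, y]" for x y using h(2)[of "[x, y]"] by simp
  obtain f' where f: "recursive n f'" "\<And>xs. length xs = n \<Longrightarrow> f xs = f' xs"
    using assms(2) by (auto simp: recursive_on_def)
  obtain g' where g: "recursive n g'" "\<And>xs. length xs = n \<Longrightarrow> g xs = g' xs"
    using assms(3) by (auto simp: recursive_on_def)
  have "recursive n (\<lambda>xs. h' (map (\<lambda>g. g xs) [f', g']))"
    by (rule recursive.comp) (use h(1) f(1) g(1) in \<open>auto simp: numeral_2_eq_2\<close>)
  then show ?thesis unfolding recursive_on_def using h2 f(2) g(2) by auto
qed

text \<open>The counter is the first argument because \<open>recursive.prec\<close> recurses on the
  head of the list. This also explains the argument order in
  \<open>computable2_diff'\<close>.\<close>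

lemma computable2_rec_nat:
  assumes "computable f" "recursive_on 3 (\<lambda>xs. g (xs ! 0) (xs ! 1) (xs ! 2))"
  shows "computable2 (\<lambda>n x. rec_nat (f x) (\<lambda>k r. g k r x) n)"
proof -
  obtain f' where f: "recursive 1 f'" "\<And>x. f x = f' [x]"
    using assms(1) by (auto simp: computable_def)
  obtain g' where g: "recursive 3 g'"
      "\<And>xs. length xs = 3 \<Longrightarrow> g (xs ! 0) (xs ! 1) (xs ! 2) = g' xs"
    using assms(2) by (auto simp: recursive_on_def)
  have g2: "g x y z = g' [x, y, z]" for x y z using g(2)[of "[x, y, z]"] by simp
  have "recursive (1 + 1) (\<lambda>xs. rec_nat (f' (tl xs)) (\<lambda>k r. g' (k # r # tl xs)) (hd xs))"
    by (rule recursive.prec) (use f(1) g(1) in \<open>auto simp: numeral_3_eq_3\<close>)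
  moreover have "rec_nat (f (xs ! 1)) (\<lambda>k r. g k r (xs ! 1)) (xs ! 0) =
      rec_nat (f' (tl xs)) (\<lambda>k r. g' (k # r # tl xs)) (hd xs)" if "length xs = 2" for xs
    using that by (auto simp: f(2) g2 length_Suc_conv numeral_2_eq_2)
  ultimately show ?thesis unfolding computable2_def recursive_on_def
    by (auto simp: numeral_2_eq_2)
qed

named_theorems computable

lemma computable_id [computable]: "computable (\<lambda>x. x)"
  by (simp add: computable_iff_recursive_on recursive_on_proj)

lemma computable_Suc': "computable Suc"
  unfolding computable_def using recursive.succ by force

lemma computable_comp:
  assumes "computable h" "computable f"
  shows "computable (\<lambda>x. h (f x))"
  using recursive_on_comp1[OF assms(1)] assms(2) by (simp add: computable_iff_recursive_on)

lemma computable_comp2: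
  assumes "computable2 h" "computable f" "computable g"
  shows "computable (\<lambda>x. h (f x) (g x))"
  using recursive_on_comp2[OF assms(1)] assms(2,3) by (simp add: computable_iff_recursive_on)

lemma computable_Suc [computable]: "computable f \<Longrightarrow> computable (\<lambda>x. Suc (f x))"
  by (rule computable_comp[OF computable_Suc'])

lemma recursive_on_const: "recursive_on n (\<lambda>xs. c)"
proof (induction c)
  case 0
  show ?case unfolding recursive_on_def using recursive.zero by blast
qed (rule recursive_on_comp1[OF computable_Suc'])

lemma computable_const [computable]: "computable (\<lambda>x. c)"
  by (simp add: computable_iff_recursive_on recursive_on_const)

lemma computable2_add: "computable2 (+)"
proof -
  have "computable2 (\<lambda>n x. rec_nat x (\<lambda>k r. Suc r) n)"
    by (rule computable2_rec_nat[OF computable_id])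
      (intro recursive_on_comp1[OF computable_Suc'] recursive_on_proj; simp)
  moreover have "rec_nat x (\<lambda>k r. Suc r) n = n + x" for n x by (induction n) auto
  ultimately show ?thesis by simp
qed

lemma computable2_mult: "computable2 (*)"
proof -
  have "computable2 (\<lambda>n x. rec_nat 0 (\<lambda>k r. r + x) n)"
    by (rule computable2_rec_nat[OF computable_const])
      (intro recursive_on_comp2[OF computable2_add] recursive_on_proj; simp)
  moreover have "rec_nat 0 (\<lambda>k r. r + x) n = n * x" for n x by (induction n) auto
  ultimately show ?thesis by simp
qed

lemma computable_pred: "computable (\<lambda>x. x - 1)"
proof -
  have "computable2 (\<lambda>n x. rec_nat 0 (\<lambda>k r. k) n)"
    by (rule computable2_rec_nat[OF computable_const]) (simp add: recursive_on_proj)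
  then have "computable (\<lambda>n. rec_nat 0 (\<lambda>k r. k) n)"
    by (rule computable_comp2) (rule computable_id)+
  moreover have "rec_nat 0 (\<lambda>k r. k) n = n - 1" for n :: nat by (cases n) auto
  ultimately show ?thesis by simp
qed

lemma computable2_diff': "computable2 (\<lambda>n x. x - n)"
proof -
  have "computable2 (\<lambda>n x. rec_nat x (\<lambda>k r. r - 1) n)"
    by (rule computable2_rec_nat[OF computable_id])
      (intro recursive_on_comp1[OF computable_pred] recursive_on_proj; simp)
  moreover have "rec_nat x (\<lambda>k r. r - 1) n = x - n" for n x :: nat by (induction n) auto
  ultimately show ?thesis by simp
qed

lemma computable_add [computable]:
  "computable f \<Longrightarrow> computable g \<Longrightarrow> computable (\<lambda>x. f x + g x)"
  by (rule computable_comp2[OF computable2_add])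

lemma computable_mult [computable]:
  "computable f \<Longrightarrow> computable g \<Longrightarrow> computable (\<lambda>x. f x * g x)"
  by (rule computable_comp2[OF computable2_mult])

lemma computable_diff [computable]:
  "computable f \<Longrightarrow> computable g \<Longrightarrow> computable (\<lambda>x. f x - g x)"
  by (rule computable_comp2[OF computable2_diff'])

section \<open>Inverting the pairing function\<close>

lemma computable_triangle: "computable triangle"
proof -
  have "computable2 (\<lambda>n x. rec_nat 0 (\<lambda>k r. r + Suc k) n)"
    by (rule computable2_rec_nat[OF computable_const])
      (intro recursive_on_comp2[OF computable2_add] recursive_on_comp1[OF computable_Suc']
        recursive_on_proj; simp)
  then have "computable (\<lambda>n. rec_nat 0 (\<lambda>k r. r + Suc k) n)"
    by (rule computable_comp2) (rule computable_id)+
  moreover have "rec_nat 0 (\<lambda>k r. r + Suc k) n = triangle n" for n by (induction n) auto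
  ultimately show ?thesis by simp
qed

lemma computable_prod_encode [computable]:
  "computable f \<Longrightarrow> computable g \<Longrightarrow> computable (\<lambda>x. prod_encode (f x, g x))"
  unfolding prod_encode_def by (simp add: computable_add computable_comp[OF computable_triangle])

abbreviation pfst :: "nat \<Rightarrow> nat" where "pfst z \<equiv> fst (prod_decode z)"
abbreviation psnd :: "nat \<Rightarrow> nat" where "psnd z \<equiv> snd (prod_decode z)"

text \<open>Since \<open>prod_encode (m, n) = triangle (m + n) + m\<close>, this is the index of the
  diagonal containing \<open>z\<close>, that is, the largest \<open>s\<close> with
  \<open>triangle s <= z\<close>. Both projections follow from it by subtraction.\<close>

definition triangle_root :: "nat \<Rightarrow> nat" where
  "triangle_root z = pfst z + psnd z"

lemma triangle_mono: "m \<le> n \<Longrightarrow> triangle m \<le> triangle n"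
  by (induction n) (auto simp: le_Suc_eq)

lemma triangle_root_eqI:
  assumes "triangle s \<le> z" "z < triangle (Suc s)"
  shows "triangle_root z = s"
proof -
  have "prod_encode (z - triangle s, s - (z - triangle s)) = z"
    using assms by (simp add: prod_encode_def)
  then have "prod_decode z = (z - triangle s, s - (z - triangle s))"
    by (metis prod_encode_inverse)
  then show ?thesis using assms by (simp add: triangle_root_def)
qed

lemma triangle_root_bounds:
  "triangle (triangle_root z) \<le> z" "z < triangle (Suc (triangle_root z))"
proof -
  have "z = prod_encode (pfst z, psnd z)" by simp
  then have z: "z = triangle (triangle_root z) + pfst z"
    unfolding prod_encode_def triangle_root_def by (simp add: case_prod_beta)
  then show "triangle (triangle_root z) \<le> z" by linarith
  show "z < triangle (Suc (triangle_root z))"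
    using z by (simp add: triangle_root_def)
qed

lemma computable_triangle_root: "computable triangle_root"
proof -
  \<comment> \<open>From \<open>k\<close> to \<open>Suc k\<close> the root grows by at most one.
    With truncated subtraction the summand is \<open>1\<close> exactly if
    \<open>triangle (Suc r) <= Suc k\<close>.\<close>
  define step where "step k r = r + (1 - (triangle (Suc r) - Suc k))" for k r
  have "computable2 (\<lambda>n x. rec_nat 0 (\<lambda>k r. step k r) n)"
    unfolding step_def
    by (rule computable2_rec_nat[OF computable_const])
      (intro recursive_on_comp2[OF computable2_add] recursive_on_comp1[OF computable_Suc']
        recursive_on_comp2[OF computable2_diff'] recursive_on_comp1[OF computable_triangle]
        recursive_on_const recursive_on_proj; simp)
  then have "computable (\<lambda>n. rec_nat 0 (\<lambda>k r. step k r) n)"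
    by (rule computable_comp2) (rule computable_id)+
  moreover have "rec_nat 0 (\<lambda>k r. step k r) n = triangle_root n" for n
  proof (induction n)
    case 0
    show ?case by (simp add: triangle_root_eqI[of 0 0])
  next
    case (Suc n)
    have "triangle_root (Suc n) = step n (triangle_root n)"
      using triangle_root_bounds[of n] unfolding step_def
      by (cases "triangle (Suc (triangle_root n)) \<le> Suc n") (auto intro!: triangle_root_eqI)
    then show ?case using Suc by simp
  qed
  ultimately show ?thesis by simp
qed

lemma computable_pfst': "computable pfst"
proof -
  have "pfst z = z - triangle (triangle_root z)" for z
    using prod_decode_inverse[of z] unfolding prod_encode_def triangle_root_def
    by (simp add: case_prod_beta)
  then show ?thesis
    by (simp add: computable_comp[OF computable_triangle] computable_triangle_root
        computable_diff computable_id)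
qed

lemma computable_psnd': "computable psnd"
proof -
  have "psnd z = triangle_root z - pfst z" for z
    by (simp add: triangle_root_def)
  then show ?thesis
    by (simp add: computable_triangle_root computable_diff computable_pfst')
qed

lemmas computable_pfst [computable] = computable_comp[OF computable_pfst']
  and computable_psnd [computable] = computable_comp[OF computable_psnd']

text \<open>Packing counter, previous value and parameter into one number keeps all side conditions
  unary, so that the rules collected in \<open>computable\<close> can discharge them.\<close>

lemma computable_rec_nat:
  assumes "computable b" "computable f"
    and g: "computable (\<lambda>p. g (pfst p) (pfst (psnd p)) (psnd (psnd p)))"
  shows "computable (\<lambda>x. rec_nat (f x) (\<lambda>k r. g k r x) (b x))"
proof -
  have pair: "computable2 (\<lambda>x y. prod_encode (x, y))"
    unfolding computable2_def prod_encode_def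
    by simp (intro recursive_on_comp2[OF computable2_add] recursive_on_comp1[OF computable_triangle]
        recursive_on_proj; simp)
  have "recursive_on 3 (\<lambda>xs. g (xs ! 0) (xs ! 1) (xs ! 2)) \<longleftrightarrow>
     recursive_on 3 (\<lambda>xs. (\<lambda>p. g (pfst p) (pfst (psnd p)) (psnd (psnd p)))
       (prod_encode (xs ! 0, prod_encode (xs ! 1, xs ! 2))))"
    by simp
  moreover have "recursive_on 3 (\<lambda>xs. (\<lambda>p. g (pfst p) (pfst (psnd p)) (psnd (psnd p)))
       (prod_encode (xs ! 0, prod_encode (xs ! 1, xs ! 2))))"
    by (intro recursive_on_comp1[OF g] recursive_on_comp2[OF pair] recursive_on_proj; simp)
  ultimately have "computable2 (\<lambda>n x. rec_nat (f x) (\<lambda>k r. g k r x) n)"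
    using assms(2) by (intro computable2_rec_nat) simp_all
  from computable_comp2[OF this assms(1) computable_id] show ?thesis .
qed

section \<open>Bounded sums and binary digits\<close>

lemma computable_sum [computable]:
  assumes "computable b" "computable (\<lambda>p. f (psnd p) (pfst p))"
  shows "computable (\<lambda>x. \<Sum>z<b x. f x z)"
proof -
  \<comment> \<open>In the recursion step \<open>p\<close> packs counter, accumulator and parameter;
    the summand needs the pair without the accumulator.\<close>
  have "computable (\<lambda>p. (\<lambda>q. f (psnd q) (pfst q)) (prod_encode (pfst p, psnd (psnd p))))"
    by (rule computable_comp[OF assms(2)]) (intro computable)
  then have "computable (\<lambda>x. rec_nat 0 (\<lambda>k r. r + f x k) (b x))"
    by (intro computable_rec_nat computable assms(1)) simp
  moreover have "rec_nat 0 (\<lambda>k r. r + f x k) n = (\<Sum>z<n. f x z)" for x n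
    by (induction n) auto
  ultimately show ?thesis by simp
qed

lemma computable_power2 [computable]:
  assumes "computable f"
  shows "computable (\<lambda>x. 2 ^ f x)"
proof -
  have "computable (\<lambda>x. rec_nat 1 (\<lambda>k r. 2 * r) (f x))"
    by (intro computable_rec_nat computable assms)
  moreover have "rec_nat 1 (\<lambda>k r. 2 * r) n = (2 :: nat) ^ n" for n by (induction n) auto
  ultimately show ?thesis by simp
qed

lemma computable_parity: "computable (\<lambda>x. x mod 2)"
proof -
  have "computable (\<lambda>x. rec_nat 0 (\<lambda>k r. 1 - r) x)"
    by (intro computable_rec_nat computable)
  moreover have "rec_nat 0 (\<lambda>k r. 1 - r) n = n mod 2" for n :: nat
    by (induction n) (auto simp: mod2_eq_if)
  ultimately show ?thesis by simp
qed

lemma computable_half: "computable (\<lambda>x. x div 2)"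
proof -
  \<comment> \<open>The sum counts the odd numbers below \<open>x\<close>.\<close>
  have "computable (\<lambda>x. \<Sum>z<x. z mod 2)"
    by (intro computable computable_comp[OF computable_parity])
  moreover have "(\<Sum>z<n. z mod 2) = n div 2" for n :: nat
  proof (induction n)
    case (Suc n)
    then show ?case by simp presburger
  qed simp
  ultimately show ?thesis by simp
qed

lemma computable_div_power2 [computable]:
  assumes "computable f" "computable g"
  shows "computable (\<lambda>x. f x div 2 ^ g x)"
proof -
  have "computable (\<lambda>x. rec_nat (f x) (\<lambda>k r. r div 2) (g x))"
    by (intro computable_rec_nat computable assms computable_comp[OF computable_half])
  moreover have "rec_nat m (\<lambda>k r. r div 2) n = m div 2 ^ n" for m n :: nat
    by (induction n) (auto simp: div_mult2_eq[symmetric] mult.commute)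
  ultimately show ?thesis by simp
qed

section \<open>Decidable predicates and coded finite sets\<close>

definition decidable :: "(nat \<Rightarrow> bool) \<Rightarrow> bool" where
  "decidable P \<longleftrightarrow> computable (\<lambda>x. of_bool (P x))"

lemma computable_of_bool [computable]: "decidable P \<Longrightarrow> computable (\<lambda>x. of_bool (P x))"
  by (simp add: decidable_def)

lemma decidable_not [computable]: "decidable P \<Longrightarrow> decidable (\<lambda>x. \<not> P x)"
proof -
  assume "decidable P"
  then have "computable (\<lambda>x. 1 - of_bool (P x))" by (intro computable)
  moreover have "of_bool (\<not> P x) = 1 - (of_bool (P x) :: nat)" for x by simp
  ultimately show ?thesis by (simp only: decidable_def)
qed

lemma decidable_conj [computable]:
  "decidable P \<Longrightarrow> decidable Q \<Longrightarrow> decidable (\<lambda>x. P x \<and> Q x)"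
  unfolding decidable_def of_bool_conj by (rule computable_mult)

lemma decidable_disj [computable]:
  assumes "decidable P" "decidable Q"
  shows "decidable (\<lambda>x. P x \<or> Q x)"
proof -
  have "decidable (\<lambda>x. \<not> (\<not> P x \<and> \<not> Q x))" by (intro computable assms)
  then show ?thesis by simp
qed

lemma decidable_le [computable]:
  assumes "computable f" "computable g"
  shows "decidable (\<lambda>x. f x \<le> g x)"
proof -
  have "computable (\<lambda>x. 1 - (f x - g x))" by (intro computable assms)
  moreover have "of_bool (f x \<le> g x) = 1 - (f x - g x)" for x by auto
  ultimately show ?thesis by (simp add: decidable_def)
qed

lemma decidable_eq [computable]:
  assumes "computable f" "computable g"
  shows "decidable (\<lambda>x. f x = g x)"
proof -
  have "decidable (\<lambda>x. f x \<le> g x \<and> g x \<le> f x)" by (intro computable assms)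
  then show ?thesis by (simp add: eq_iff)
qed

text \<open>Bounded search by counting the witnesses.\<close>

lemma decidable_bex [computable]:
  assumes "computable b" "decidable (\<lambda>p. P (psnd p) (pfst p))"
  shows "decidable (\<lambda>x. \<exists>z<b x. P x z)"
proof -
  have "decidable (\<lambda>x. \<not> (\<Sum>z<b x. of_bool (P x z)) = (0 :: nat))"
    by (intro computable assms)
  moreover have "(\<exists>z<b x. P x z) \<longleftrightarrow> (\<Sum>z<b x. of_bool (P x z)) \<noteq> (0 :: nat)" for x
    by (simp only: sum_eq_0_iff finite_lessThan) (auto simp: of_bool_def)
  ultimately show ?thesis by (simp only:)
qed

lemma decidable_set_decode [computable]:
  assumes "computable f" "computable g"
  shows "decidable (\<lambda>x. f x \<in> set_decode (g x))"
proof -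
  have "decidable (\<lambda>x. (g x div 2 ^ f x) mod 2 = 1)"
    by (intro computable computable_comp[OF computable_parity] assms)
  then show ?thesis by (simp add: set_decode_def odd_iff_mod_2_eq_one)
qed

lemma computable_set_encode [computable]:
  assumes "computable b" "decidable (\<lambda>p. P (psnd p) (pfst p))"
  shows "computable (\<lambda>x. set_encode {z. z < b x \<and> P x z})"
proof -
  have "computable (\<lambda>p. of_bool (P (psnd p) (pfst p)) * 2 ^ pfst p)"
    using assms by (intro computable)
  then have "computable (\<lambda>x. \<Sum>z<b x. of_bool (P x z) * 2 ^ z)"
    using assms by (intro computable)
  moreover have "set_encode {z. z < n \<and> P x z} = (\<Sum>z<n. of_bool (P x z) * 2 ^ z)" for n x
    unfolding set_encode_def by (rule sum.mono_neutral_cong_left) auto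
  ultimately show ?thesis by simp
qed

section \<open>Weighted paths\<close>

definition path :: "('q, 'a) wfa \<Rightarrow> 'q \<Rightarrow> 'a list \<Rightarrow> int \<Rightarrow> 'q \<Rightarrow> bool" where
  "path A p w k q \<longleftrightarrow> (\<exists>\<rho>. is_run A p w \<rho> q \<and> run_weight \<rho> = k)"

text \<open>Distinct runs of equal weight are merged here. That is enough for values, but not for
  ambiguity, so \<open>unambiguous_guess_wfa\<close> returns to runs.\<close>

definition accepted_weights :: "('q, 'a) wfa \<Rightarrow> 'q \<Rightarrow> 'a list \<Rightarrow> int set" where
  "accepted_weights A p w = {k. \<exists>q\<in>final A. path A p w k q}"

lemma run_weight_simps [simp]:
  "run_weight [] = 0"
  "run_weight ((p, a, c, q) # \<rho>) = int_of c + run_weight \<rho>"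
  by (simp_all add: run_weight_def)

lemma is_run_Nil_iff: "is_run A p [] \<rho> q \<longleftrightarrow> \<rho> = [] \<and> p = q"
  by (cases \<rho>) auto

lemma is_run_Cons_iff:
  "is_run A p (a # w) \<rho> q \<longleftrightarrow>
     (\<exists>k r \<rho>'. \<rho> = (p, a, Fin k, r) # \<rho>' \<and> (p, a, Fin k, r) \<in> delta A \<and> is_run A r w \<rho>' q)"
proof (cases \<rho>)
  case (Cons t \<rho>')
  obtain p' a' c r where "t = (p', a', c, r)" by (cases t)
  then show ?thesis using Cons by (cases c) auto
qed simp

lemma path_Nil [simp]: "path A p [] k q \<longleftrightarrow> k = 0 \<and> p = q"
  by (auto simp: path_def is_run_Nil_iff)

lemma path_Cons:
  "path A p (a # w) k q \<longleftrightarrow>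
     (\<exists>c r k'. (p, a, Fin c, r) \<in> delta A \<and> path A r w k' q \<and> k = c + k')"
  unfolding path_def is_run_Cons_iff by force

lemma path_append:
  "path A p (v @ w) k q \<longleftrightarrow> (\<exists>r i j. path A p v i r \<and> path A r w j q \<and> k = i + j)"
proof (induction v arbitrary: p k)
  case (Cons a v)
  have "path A p ((a # v) @ w) k q \<longleftrightarrow>
      (\<exists>c s k' r i j. (p, a, Fin c, s) \<in> delta A \<and> path A s v i r \<and> path A r w j q \<and>
         k' = i + j \<and> k = c + k')"
    unfolding append_Cons path_Cons Cons by blast
  also have "\<dots> \<longleftrightarrow> (\<exists>r i j. path A p (a # v) i r \<and> path A r w j q \<and> k = i + j)"
    unfolding path_Cons by (auto simp: add.assoc) (metis add.assoc)+
  finally show ?case .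
qed auto

lemma accepted_weights_append:
  "accepted_weights A p (v @ w) =
     {i + j |i j q. path A p v i q \<and> j \<in> accepted_weights A q w}"
  unfolding accepted_weights_def path_append by blast

lemma accepted_weights_appendI:
  "path A p v i q \<Longrightarrow> j \<in> accepted_weights A q w \<Longrightarrow> i + j \<in> accepted_weights A p (v @ w)"
  unfolding accepted_weights_append by blast

lemma accepted_weights_Nil: "accepted_weights A p [] = (if p \<in> final A then {0} else {})"
  by (auto simp: accepted_weights_def)

lemma accepted_weights_Cons:
  "accepted_weights A p (a # w) =
     {c + k |c k q. (p, a, Fin c, q) \<in> delta A \<and> k \<in> accepted_weights A q w}"
  unfolding accepted_weights_def path_Cons by blast

lemma accepted_weights_eq_run_weight:
  "accepted_weights A (init A) w = {run_weight \<rho> |\<rho>. accepting_run A w \<rho>}"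
  unfolding accepted_weights_def path_def accepting_run_def by blast

lemma finite_accepted_weights:
  "is_wfa A \<Longrightarrow> finite (accepted_weights A (init A) w)"
  unfolding accepted_weights_eq_run_weight
  using finite_imageI[OF finite_accepting_runs, of A run_weight w]
  by (simp add: image_Collect)

lemma wfa_value_eq:
  "wfa_value A w =
     (if accepted_weights A (init A) w = {} then Infty
      else Fin (Min (accepted_weights A (init A) w)))"
  unfolding wfa_value_def accepted_weights_eq_run_weight by auto

lemma wfa_value_eq_Fin_iff:
  assumes "is_wfa A"
  shows "wfa_value A w = Fin k \<longleftrightarrow>
    k \<in> accepted_weights A (init A) w \<and> (\<forall>j\<in>accepted_weights A (init A) w. k \<le> j)"
  using finite_accepted_weights[OF assms, of w] unfolding wfa_value_eq
  by (auto simp: eq_Min_iff[symmetric])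

lemma delta_subset:
  assumes "is_wfa A" "(p, a, c, q) \<in> delta A"
  shows "p \<in> states A" "a \<in> alphabet A" "q \<in> states A"
  using assms unfolding is_wfa_def by auto

lemma path_states:
  assumes "is_wfa A" "path A p w k q" "p \<in> states A"
  shows "q \<in> states A" "set w \<subseteq> alphabet A"
proof -
  have "q \<in> states A \<and> set w \<subseteq> alphabet A"
    using assms(2,3)
    by (induction w arbitrary: p k) (fastforce simp: path_Cons dest: delta_subset[OF assms(1)])+
  then show "q \<in> states A" "set w \<subseteq> alphabet A" by auto
qed

lemma accepted_weights_lists:
  assumes "is_wfa A" "k \<in> accepted_weights A (init A) w"
  shows "w \<in> lists (alphabet A)"
proof -
  have "init A \<in> states A" using assms(1) by (simp add: is_wfa_def)
  then show ?thesis
    using assms path_states(2)[of A "init A" w k]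
    unfolding accepted_weights_def lists_eq_set by blast
qed

lemma wfa_value_Infty_iff: "wfa_value A w = Infty \<longleftrightarrow> accepted_weights A (init A) w = {}"
  by (simp add: wfa_value_eq)

section \<open>The automaton with announced lookahead\<close>

definition predecessors :: "('q, 'a) wfa \<Rightarrow> 'a \<Rightarrow> 'q set \<Rightarrow> 'q set" where
  "predecessors A a S = {p. \<exists>q\<in>S. \<exists>k. (p, a, Fin k, q) \<in> delta A}"

text \<open>The announcement in \<open>l\<close> concerns the word after \<open>l\<close>, the one
  stored in \<open>s\<close> the word beginning with \<open>l\<close>. Hence the stored set must
  consist of the predecessors of the new one; before the first letter there is nothing to
  check.\<close>

definition lookahead_step :: "(nat, nat) wfa \<Rightarrow> nat \<Rightarrow> nat \<Rightarrow> nat \<Rightarrow> bool" where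
  "lookahead_step A s l s' \<longleftrightarrow>
     psnd s' = Suc (psnd l) \<and>
     (psnd s = 0 \<or> psnd s = Suc (set_encode (predecessors A (pfst l) (set_decode (psnd l)))))"

text \<open>
  A letter of \<open>lookahead_wfa A\<close> is a pair of a letter of \<open>A\<close> and the code of a set of states,
  announced to be the set of states from which \<open>A\<close> accepts the rest of the word. A state is a pair
  of a state of \<open>A\<close> and the last announcement, shifted by one; \<open>0\<close> means that there is none yet.
\<close>

definition lookahead_wfa :: "(nat, nat) wfa \<Rightarrow> (nat, nat) wfa" where
  "lookahead_wfa A =
     (let N = set_encode (states A);
          Q = {s. pfst s \<in> states A \<and> psnd s \<le> Suc N};
          L = {l. pfst l \<in> alphabet A \<and> psnd l \<le> N}
      in \<lparr>states = Q, alphabet = L, init = prod_encode (init A, 0),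
          delta = {(s, l, c, s'). s \<in> Q \<and> l \<in> L \<and> s' \<in> Q \<and>
             (if lookahead_step A s l s' then (pfst s, pfst l, c, pfst s') \<in> delta A else c = Infty)},
          final = {s \<in> Q. pfst s \<in> final A \<and>
             (psnd s = 0 \<or> psnd s = Suc (set_encode (final A)))}\<rparr>)"

lemma lookahead_wfa_sel:
  "s \<in> states (lookahead_wfa A) \<longleftrightarrow> pfst s \<in> states A \<and> psnd s \<le> Suc (set_encode (states A))"
  "l \<in> alphabet (lookahead_wfa A) \<longleftrightarrow> pfst l \<in> alphabet A \<and> psnd l \<le> set_encode (states A)"
  "init (lookahead_wfa A) = prod_encode (init A, 0)"
  "(s, l, c, s') \<in> delta (lookahead_wfa A) \<longleftrightarrow>
     s \<in> states (lookahead_wfa A) \<and> l \<in> alphabet (lookahead_wfa A) \<and>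
     s' \<in> states (lookahead_wfa A) \<and>
     (if lookahead_step A s l s' then (pfst s, pfst l, c, pfst s') \<in> delta A else c = Infty)"
  "s \<in> final (lookahead_wfa A) \<longleftrightarrow>
     s \<in> states (lookahead_wfa A) \<and> pfst s \<in> final A \<and>
     (psnd s = 0 \<or> psnd s = Suc (set_encode (final A)))"
  by (auto simp: lookahead_wfa_def Let_def)

lemma finite_prod_decode:
  assumes "finite P" "finite R"
  shows "finite {z. pfst z \<in> P \<and> psnd z \<in> R}"
proof (rule finite_subset)
  show "{z. pfst z \<in> P \<and> psnd z \<in> R} \<subseteq> prod_encode ` (P \<times> R)"
    by (auto intro!: image_eqI[of _ _ "prod_decode _"] simp: mem_Times_iff)
qed (use assms in simp)

lemma is_wfa_lookahead_wfa:
  assumes "is_wfa A"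
  shows "is_wfa (lookahead_wfa A)"
  unfolding is_wfa_def
proof (intro conjI ballI)
  have A: "finite (states A)" "finite (alphabet A)" "init A \<in> states A"
    using assms by (auto simp: is_wfa_def)
  have "finite {s. pfst s \<in> states A \<and> psnd s \<in> {.. Suc (set_encode (states A))}}"
    "finite {l. pfst l \<in> alphabet A \<and> psnd l \<in> {.. set_encode (states A)}}"
    by (intro finite_prod_decode A finite_atMost)+
  then show "finite (states (lookahead_wfa A))" "finite (alphabet (lookahead_wfa A))"
    by (simp_all add: lookahead_wfa_def Let_def)
  show "init (lookahead_wfa A) \<in> states (lookahead_wfa A)"
    using A by (simp add: lookahead_wfa_sel)
  show "final (lookahead_wfa A) \<subseteq> states (lookahead_wfa A)"
    "delta (lookahead_wfa A) \<subseteq> states (lookahead_wfa A) \<times> alphabet (lookahead_wfa A) \<times> UNIV \<times>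
       states (lookahead_wfa A)"
    by (auto simp: lookahead_wfa_sel(4,5))
next
  fix p q a assume "p \<in> states (lookahead_wfa A)" "q \<in> states (lookahead_wfa A)"
    "a \<in> alphabet (lookahead_wfa A)"
  moreover from calculation have "\<exists>!c. (pfst p, pfst a, c, pfst q) \<in> delta A"
    using assms by (simp add: is_wfa_def lookahead_wfa_sel)
  ultimately show "\<exists>!c. (p, a, c, q) \<in> delta (lookahead_wfa A)"
    by (cases "lookahead_step A p a q") (simp_all add: lookahead_wfa_sel(4))
qed

section \<open>The construction on codes of automata\<close>

lemma less_if_mem_set_decode:
  assumes "z \<in> set_decode n"
  shows "z < n"
proof -
  have "set_encode {z} \<le> set_encode (set_decode n)"
    by (rule subset_decode_imp_le) (use assms in \<open>simp del: set_encode_insert\<close>)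
  then have "2 ^ z \<le> n" by simp
  then show ?thesis using less_exp[of z] by (rule less_le_trans[rotated])
qed

lemma prod_encode_mono: "a \<le> c \<Longrightarrow> b \<le> d \<Longrightarrow> prod_encode (a, b) \<le> prod_encode (c, d)"
  by (simp add: prod_encode_def add_mono triangle_mono)

lemma prod_decode_le:
  assumes "pfst z \<le> a" "psnd z \<le> b"
  shows "z \<le> prod_encode (a, b)"
  using prod_encode_mono[OF assms] by simp

text \<open>Here \<open>x\<close> codes a whole automaton and
  \<open>pfst (psnd (psnd (psnd x)))\<close> its transition set. A weight code other than
  \<open>0\<close> is a finite weight.\<close>

definition code_predecessors :: "nat \<Rightarrow> nat \<Rightarrow> nat \<Rightarrow> nat" where
  "code_predecessors x a n =
     set_encode {p. p < x \<and> (\<exists>q<x. \<exists>c<x. q \<in> set_decode n \<and> \<not> c = 0 \<and>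
       prod_encode (p, prod_encode (a, prod_encode (c, q))) \<in> set_decode (pfst (psnd (psnd (psnd x)))))}"

definition code_step :: "nat \<Rightarrow> nat \<Rightarrow> nat \<Rightarrow> nat \<Rightarrow> bool" where
  "code_step x s l s' \<longleftrightarrow>
     psnd s' = Suc (psnd l) \<and> (psnd s = 0 \<or> psnd s = Suc (code_predecessors x (pfst l) (psnd l)))"

definition code_state :: "nat \<Rightarrow> nat \<Rightarrow> bool" where
  "code_state x s \<longleftrightarrow> pfst s \<in> set_decode (pfst x) \<and> psnd s \<le> Suc (pfst x)"

definition code_letter :: "nat \<Rightarrow> nat \<Rightarrow> bool" where
  "code_letter x l \<longleftrightarrow> pfst l \<in> set_decode (pfst (psnd x)) \<and> psnd l \<le> pfst x"

definition code_transition :: "nat \<Rightarrow> nat \<Rightarrow> nat \<Rightarrow> nat \<Rightarrow> nat \<Rightarrow> bool" where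
  "code_transition x s l c s' \<longleftrightarrow> code_state x s \<and> code_letter x l \<and> code_state x s' \<and>
     (code_step x s l s' \<and> prod_encode (pfst s, prod_encode (pfst l, prod_encode (c, pfst s')))
         \<in> set_decode (pfst (psnd (psnd (psnd x)))) \<or>
      \<not> code_step x s l s' \<and> c = 0)"

definition code_final :: "nat \<Rightarrow> nat \<Rightarrow> bool" where
  "code_final x s \<longleftrightarrow> code_state x s \<and> pfst s \<in> set_decode (psnd (psnd (psnd (psnd x)))) \<and>
     (psnd s = 0 \<or> psnd s = Suc (psnd (psnd (psnd (psnd x)))))"

text \<open>As pairing is monotone, pairing bounds of the components bounds the pairs. The
  components are at most \<open>x\<close>, except that stored announcements are shifted by one,
  whence \<open>Suc x\<close>.\<close>

definition code_lookahead :: "nat \<Rightarrow> nat" where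
  "code_lookahead x =
     prod_encode (set_encode {s. s < Suc (prod_encode (x, Suc x)) \<and> code_state x s},
     prod_encode (set_encode {l. l < Suc (prod_encode (x, x)) \<and> code_letter x l},
     prod_encode (prod_encode (pfst (psnd (psnd x)), 0),
     prod_encode (set_encode {t. t < Suc (prod_encode (prod_encode (x, Suc x),
         prod_encode (prod_encode (x, x), prod_encode (x, prod_encode (x, Suc x))))) \<and>
       code_transition x (pfst t) (pfst (psnd t)) (pfst (psnd (psnd t))) (psnd (psnd (psnd t)))},
     set_encode {s. s < Suc (prod_encode (x, Suc x)) \<and> code_final x s}))))"

lemma computable_code_lookahead: "computable code_lookahead"
proof -
  have [computable]: "computable (\<lambda>x. code_predecessors (f x) (g x) (h x))"
    if "computable f" "computable g" "computable h" for f g h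
    unfolding code_predecessors_def
    \<comment> \<open>Under the bounded quantifiers the parameter is buried in nested pairs, so
      \<open>f\<close>, \<open>g\<close> and \<open>h\<close> get composed with projections.\<close>
    by (intro computable that computable_comp[OF that(1)] computable_comp[OF that(2)]
        computable_comp[OF that(3)])
  have [computable]: "decidable (\<lambda>x. code_step (f x) (g x) (h x) (k x))"
    if "computable f" "computable g" "computable h" "computable k" for f g h k
    unfolding code_step_def using that by (intro computable)
  have [computable]: "decidable (\<lambda>x. code_state (f x) (g x))"
      "decidable (\<lambda>x. code_letter (f x) (g x))"
    if "computable f" "computable g" for f g
    unfolding code_state_def code_letter_def by (intro computable that)+
  have [computable]: "decidable (\<lambda>x. code_transition (f x) (g x) (h x) (k x) (l x))"
    if "computable f" "computable g" "computable h" "computable k" "computable l" for f g h k l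
    unfolding code_transition_def using that by (intro computable)
  have [computable]: "decidable (\<lambda>x. code_final (f x) (g x))"
    if "computable f" "computable g" for f g
    unfolding code_final_def using that by (intro computable)
  show ?thesis unfolding code_lookahead_def by (intro computable)
qed

text \<open>Thus a number found in the weight position of a tuple always decodes to a
  weight.\<close>

lemma surj_zinf_encode: "\<exists>c. zinf_encode c = n"
proof (cases n)
  case 0
  then show ?thesis by (metis zinf_encode.simps(1))
next
  case (Suc m)
  then show ?thesis by (metis zinf_encode.simps(2) int_decode_inverse)
qed

lemma code_lookahead_eq:
  assumes A: "is_wfa A"
  shows "code_lookahead (wfa_encode A) = wfa_encode (lookahead_wfa A)"
proof -
  define x where "x = wfa_encode A"
  let ?D = "transition_encode ` delta A"
  have fin: "finite (states A)" "finite (alphabet A)" "finite (final A)" "finite ?D"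
    using A finite_delta[OF A] by (auto simp: is_wfa_def intro: finite_subset)
  have x: "x = prod_encode (set_encode (states A), prod_encode (set_encode (alphabet A),
      prod_encode (init A, prod_encode (set_encode ?D, set_encode (final A)))))"
    by (simp add: x_def wfa_encode_def)
  have dec: "pfst x = set_encode (states A)" "pfst (psnd x) = set_encode (alphabet A)"
      "pfst (psnd (psnd x)) = init A" "pfst (psnd (psnd (psnd x))) = set_encode ?D"
      "psnd (psnd (psnd (psnd x))) = set_encode (final A)"
    by (simp_all add: x)
  have le: "set_encode (states A) \<le> x" "set_encode (alphabet A) \<le> x" "set_encode ?D \<le> x"
    unfolding x by (meson le_prod_encode_1 le_prod_encode_2 order_trans)+
  have lt: "z < set_encode S" if "z \<in> S" "finite S" for z S
    using less_if_mem_set_decode[of z "set_encode S"] that by simp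
  have D: "prod_encode (p, prod_encode (a, prod_encode (zinf_encode c, q))) \<in> ?D \<longleftrightarrow>
      (p, a, c, q) \<in> delta A" for p a c q
    using inj_image_mem_iff[OF inj_transition_encode, of "(p, a, c, q)"] by simp
  have pre: "code_predecessors x a n = set_encode (predecessors A a (set_decode n))" for a n
  proof -
    have "p < x \<and> q < x \<and> zinf_encode c < x" if "(p, a, c, q) \<in> delta A" for p c q
    proof -
      have "prod_encode (p, prod_encode (a, prod_encode (zinf_encode c, q))) < x"
        using that lt[OF _ fin(4)] le(3) unfolding D[symmetric] by fastforce
      then show ?thesis by (meson le_prod_encode_1 le_prod_encode_2 le_less_trans)
    qed
    \<comment> \<open>The search bounds exclude no transition of \<open>A\<close>.\<close>
    then have edge: "p < x \<and> q < x \<and> zinf_encode c < x \<and> (p, a, c, q) \<in> delta A \<longleftrightarrow>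
        (p, a, c, q) \<in> delta A" for p c q by blast
    have "p < x \<and> (\<exists>q<x. \<exists>c<x. q \<in> set_decode n \<and> \<not> c = 0 \<and>
       prod_encode (p, prod_encode (a, prod_encode (c, q))) \<in> ?D) \<longleftrightarrow>
       (\<exists>q\<in>set_decode n. \<exists>k. (p, a, Fin k, q) \<in> delta A)" (is "?l \<longleftrightarrow> ?r") for p
    proof
      assume ?l
      then obtain q c where q: "q \<in> set_decode n" and c: "c \<noteq> 0"
          "prod_encode (p, prod_encode (a, prod_encode (c, q))) \<in> ?D"
        by blast
      obtain c' where c': "c = zinf_encode c'" using surj_zinf_encode by metis
      then obtain k where "c' = Fin k" using c(1) by (cases c') auto
      then show ?r using q c(2) unfolding c' D by blast
    next
      assume ?r
      then obtain q k where q: "q \<in> set_decode n" and d: "(p, a, Fin k, q) \<in> delta A" by blast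
      have "zinf_encode (Fin k) \<noteq> 0" by simp
      then show ?l using q d edge[of p q "Fin k"] D[of p a "Fin k" q] by blast
    qed
    moreover have "set_decode (pfst (psnd (psnd (psnd x)))) = ?D"
      using fin by (simp add: dec)
    ultimately show ?thesis
      by (simp add: code_predecessors_def predecessors_def)
  qed
  have step: "code_step x s l s' \<longleftrightarrow> lookahead_step A s l s'" for s l s'
    by (simp add: code_step_def lookahead_step_def pre)
  have state: "code_state x s \<longleftrightarrow> s \<in> states (lookahead_wfa A)" for s
    using fin by (simp add: code_state_def lookahead_wfa_sel dec)
  have letter: "code_letter x l \<longleftrightarrow> l \<in> alphabet (lookahead_wfa A)" for l
    using fin by (simp add: code_letter_def lookahead_wfa_sel dec)
  have transition: "code_transition x s l (zinf_encode c) s' \<longleftrightarrow>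
      (s, l, c, s') \<in> delta (lookahead_wfa A)" for s l c s'
    unfolding code_transition_def lookahead_wfa_sel(4) step state letter
    using fin D[of "pfst s" "pfst l" c "pfst s'"] by (cases c) (simp_all add: dec)
  have final: "code_final x s \<longleftrightarrow> s \<in> final (lookahead_wfa A)" for s
    using fin by (auto simp: code_final_def lookahead_wfa_sel(5) state dec)
  have s_le: "s \<le> prod_encode (x, Suc x)" if "s \<in> states (lookahead_wfa A)" for s
    using that lt[OF _ fin(1)] le(1)
    by (intro prod_decode_le) (fastforce simp: lookahead_wfa_sel(1))+
  have l_le: "l \<le> prod_encode (x, x)" if "l \<in> alphabet (lookahead_wfa A)" for l
    using that lt[OF _ fin(2)] le
    by (intro prod_decode_le) (fastforce simp: lookahead_wfa_sel(2))+
  have c_le: "zinf_encode c \<le> x" if "(p, a, c, q) \<in> delta A" for p a c q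
  proof -
    have "prod_encode (p, prod_encode (a, prod_encode (zinf_encode c, q))) \<le> x"
      using that lt[OF _ fin(4)] le(3) unfolding D[symmetric] by fastforce
    then show ?thesis by (meson le_prod_encode_1 le_prod_encode_2 le_trans)
  qed
  have "{t. t < Suc (prod_encode (prod_encode (x, Suc x),
         prod_encode (prod_encode (x, x), prod_encode (x, prod_encode (x, Suc x))))) \<and>
       code_transition x (pfst t) (pfst (psnd t)) (pfst (psnd (psnd t))) (psnd (psnd (psnd t)))}
    = transition_encode ` delta (lookahead_wfa A)" (is "{t. t < ?b \<and> ?P t} = _")
  proof (intro equalityI subsetI)
    fix t assume "t \<in> {t. t < ?b \<and> ?P t}"
    then have P: "?P t" by simp
    obtain c where c: "zinf_encode c = pfst (psnd (psnd t))" using surj_zinf_encode by blast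
    have "transition_encode (pfst t, pfst (psnd t), c, psnd (psnd (psnd t))) = t"
      by (simp add: c)
    moreover have "(pfst t, pfst (psnd t), c, psnd (psnd (psnd t))) \<in> delta (lookahead_wfa A)"
      using P by (simp add: transition[symmetric] c)
    ultimately show "t \<in> transition_encode ` delta (lookahead_wfa A)" by (metis imageI)
  next
    fix t assume "t \<in> transition_encode ` delta (lookahead_wfa A)"
    then obtain s l c s' where t: "t = transition_encode (s, l, c, s')"
        and d: "(s, l, c, s') \<in> delta (lookahead_wfa A)" by auto
    \<comment> \<open>Either the lookahead check fails and the weight code is \<open>0\<close>, or
      the weight already occurs in \<open>A\<close>.\<close>
    have "zinf_encode c \<le> x"
      using d c_le by (auto simp: lookahead_wfa_sel(4) split: if_splits)
    then have "t < ?b"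
      using d s_le l_le unfolding t transition_encode.simps less_Suc_eq_le lookahead_wfa_sel(4)
      by (intro prod_encode_mono) auto
    then show "t \<in> {t. t < ?b \<and> ?P t}" using d by (simp add: t transition)
  qed
  moreover have "{s. s < Suc (prod_encode (x, Suc x)) \<and> code_state x s} = states (lookahead_wfa A)"
    "{l. l < Suc (prod_encode (x, x)) \<and> code_letter x l} = alphabet (lookahead_wfa A)"
    using s_le l_le by (auto simp: state letter less_Suc_eq_le)
  moreover have "{s. s < Suc (prod_encode (x, Suc x)) \<and> code_final x s} = final (lookahead_wfa A)"
    using s_le by (auto simp: final less_Suc_eq_le lookahead_wfa_sel(5))
  moreover have "prod_encode (pfst (psnd (psnd x)), 0) = init (lookahead_wfa A)"
    by (simp add: dec lookahead_wfa_sel)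
  ultimately show ?thesis
    unfolding x_def[symmetric] code_lookahead_def wfa_encode_def[of "lookahead_wfa A"]
    by (simp only:)
qed

lemma wfa_computable_lookahead_wfa: "wfa_computable lookahead_wfa"
  unfolding wfa_computable_def using computable_code_lookahead code_lookahead_eq by blast

section \<open>Words with their correct annotation\<close>

definition accepting_states :: "('q, 'a) wfa \<Rightarrow> 'a list \<Rightarrow> 'q set" where
  "accepting_states A w = {p. accepted_weights A p w \<noteq> {}}"

lemma accepting_states_Nil [simp]: "accepting_states A [] = final A"
  by (auto simp: accepting_states_def accepted_weights_Nil)

lemma accepting_states_Cons [simp]:
  "accepting_states A (a # w) = predecessors A a (accepting_states A w)"
  by (auto simp: accepting_states_def accepted_weights_Cons predecessors_def)

lemma accepting_states_subset: "is_wfa A \<Longrightarrow> accepting_states A w \<subseteq> states A"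
proof (induction w)
  case Nil
  then show ?case by (simp add: is_wfa_def)
next
  case (Cons a w)
  then show ?case using delta_subset[OF Cons.prems] by (auto simp: predecessors_def)
qed

lemma finite_accepting_states: "is_wfa A \<Longrightarrow> finite (accepting_states A w)"
  using accepting_states_subset finite_subset unfolding is_wfa_def by metis

fun annotate :: "(nat, nat) wfa \<Rightarrow> nat list \<Rightarrow> nat list" where
  "annotate A [] = []"
| "annotate A (a # w) = prod_encode (a, set_encode (accepting_states A w)) # annotate A w"

lemma map_pfst_annotate [simp]: "map pfst (annotate A w) = w"
  by (induction w) auto

lemma annotate_eq_Nil_iff [simp]: "annotate A w = [] \<longleftrightarrow> w = []"
  by (cases w) auto

lemma length_annotate [simp]: "length (annotate A w) = length w"
  by (induction w) auto

lemma set_encode_accepting_states_le: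
  "is_wfa A \<Longrightarrow> set_encode (accepting_states A w) \<le> set_encode (states A)"
  by (intro subset_decode_imp_le)
    (simp add: finite_accepting_states accepting_states_subset, simp add: is_wfa_def accepting_states_subset)

lemma annotate_in_lists:
  "is_wfa A \<Longrightarrow> w \<in> lists (alphabet A) \<Longrightarrow> annotate A w \<in> lists (alphabet (lookahead_wfa A))"
  by (induction w) (auto simp: lookahead_wfa_sel set_encode_accepting_states_le)

text \<open>The announcement stored in a state is a promise about the remaining word. Each step
  reduces it to the promise of the next letter, and the final states settle the last one, for the
  empty word.\<close>

lemma accepted_weights_lookahead_wfa:
  assumes A: "is_wfa A" and "s \<in> states (lookahead_wfa A)"
  shows "accepted_weights (lookahead_wfa A) s W =
    (if W = annotate A (map pfst W) \<and>
        (psnd s = 0 \<or> psnd s = Suc (set_encode (accepting_states A (map pfst W))))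
     then accepted_weights A (pfst s) (map pfst W) else {})"
  using assms(2)
proof (induction W arbitrary: s)
  case Nil
  then show ?case by (auto simp: accepted_weights_Nil lookahead_wfa_sel(5))
next
  case (Cons l W)
  let ?B = "lookahead_wfa A" and ?w = "map pfst W"
  let ?S = "accepting_states A ?w"
  let ?ok = "W = annotate A ?w \<and> psnd l = set_encode ?S \<and>
    (psnd s = 0 \<or> psnd s = Suc (set_encode (predecessors A (pfst l) ?S)))"
  have dec: "set_decode (set_encode ?S) = ?S" using A by (simp add: finite_accepting_states)
  have l: "l = prod_encode (pfst l, n) \<longleftrightarrow> psnd l = n" for n
    by (metis prod_decode_inverse prod_encode_inverse prod.collapse snd_conv)
  have ok: "?ok \<longleftrightarrow> l # W = annotate A (map pfst (l # W)) \<and>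
        (psnd s = 0 \<or> psnd s = Suc (set_encode (accepting_states A (map pfst (l # W)))))"
    by (auto simp: l)
  have "m \<in> accepted_weights ?B s (l # W) \<longleftrightarrow> ?ok \<and> m \<in> accepted_weights A (pfst s) (pfst l # ?w)"
    for m
  proof
    assume "m \<in> accepted_weights ?B s (l # W)"
    then obtain c k s' where d: "(s, l, Fin c, s') \<in> delta ?B"
        and k: "k \<in> accepted_weights ?B s' W" and m: "m = c + k"
      by (auto simp: accepted_weights_Cons)
    have s': "s' \<in> states ?B" and step: "lookahead_step A s l s'"
        and dA: "(pfst s, pfst l, Fin c, pfst s') \<in> delta A"
      using d by (auto simp: lookahead_wfa_sel(4) split: if_splits)
    have "W = annotate A ?w \<and> (psnd s' = 0 \<or> psnd s' = Suc (set_encode ?S))"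
        and kA: "k \<in> accepted_weights A (pfst s') ?w"
      using k unfolding Cons.IH[OF s'] by (auto split: if_splits)
    \<comment> \<open>Here \<open>psnd s' = Suc (psnd l)\<close> is not \<open>0\<close>, so the
      induction hypothesis confirms the announcement of \<open>l\<close>; the step condition then
      confirms that of \<open>s\<close>.\<close>
    then have ?ok using step dec by (auto simp: lookahead_step_def)
    then show "?ok \<and> m \<in> accepted_weights A (pfst s) (pfst l # ?w)"
      using dA kA m unfolding accepted_weights_Cons by blast
  next
    assume asm: "?ok \<and> m \<in> accepted_weights A (pfst s) (pfst l # ?w)"
    then obtain c k q where d: "(pfst s, pfst l, Fin c, q) \<in> delta A"
        and k: "k \<in> accepted_weights A q ?w" and m: "m = c + k"
      by (auto simp: accepted_weights_Cons)
    define s' where "s' = prod_encode (q, Suc (set_encode ?S))"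
    have s': "s' \<in> states ?B"
      using delta_subset[OF A d] A
      by (simp add: lookahead_wfa_sel s'_def set_encode_accepting_states_le)
    have "l \<in> alphabet ?B"
      using delta_subset[OF A d] A asm by (simp add: lookahead_wfa_sel set_encode_accepting_states_le)
    moreover have "lookahead_step A s l s'"
      using asm dec by (simp add: lookahead_step_def s'_def)
    ultimately have "(s, l, Fin c, s') \<in> delta ?B"
      using d s' Cons.prems by (simp add: lookahead_wfa_sel(4)) (simp add: s'_def)
    moreover have "k \<in> accepted_weights ?B s' W"
      unfolding Cons.IH[OF s'] using k asm by (simp add: s'_def)
    ultimately show "m \<in> accepted_weights ?B s (l # W)"
      unfolding accepted_weights_Cons m by blast
  qed
  then show ?case unfolding ok[symmetric] by auto
qed

lemma accepted_weights_init_lookahead_wfa: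
  assumes "is_wfa A"
  shows "accepted_weights (lookahead_wfa A) (init (lookahead_wfa A)) W =
    (if W = annotate A (map pfst W) then accepted_weights A (init A) (map pfst W) else {})"
  using accepted_weights_lookahead_wfa[OF assms, of "init (lookahead_wfa A)"]
    is_wfa_lookahead_wfa[OF assms]
  by (simp add: is_wfa_def lookahead_wfa_sel(3))

section \<open>From deterministic to unambiguous automata\<close>

text \<open>
  A state of \<open>guess_wfa D f S\<close> remembers, shifted by one, the last letter of \<open>D\<close> that was guessed.
\<close>

definition guess_wfa :: "(nat, nat) wfa \<Rightarrow> (nat \<Rightarrow> nat) \<Rightarrow> nat set \<Rightarrow> (nat, nat) wfa" where
  "guess_wfa D f S =
     (let Q = {s. pfst s \<in> states D \<and> psnd s \<in> insert 0 (Suc ` alphabet D)}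
      in \<lparr>states = Q, alphabet = S, init = prod_encode (init D, 0),
          delta = {(s, a, c, s'). s \<in> Q \<and> a \<in> S \<and> s' \<in> Q \<and>
             (if psnd s' \<noteq> 0 \<and> f (psnd s' - 1) = a
              then (pfst s, psnd s' - 1, c, pfst s') \<in> delta D else c = Infty)},
          final = {s \<in> Q. pfst s \<in> final D}\<rparr>)"

lemma guess_wfa_sel:
  "s \<in> states (guess_wfa D f S) \<longleftrightarrow> pfst s \<in> states D \<and> psnd s \<in> insert 0 (Suc ` alphabet D)"
  "alphabet (guess_wfa D f S) = S"
  "init (guess_wfa D f S) = prod_encode (init D, 0)"
  "(s, a, c, s') \<in> delta (guess_wfa D f S) \<longleftrightarrow>
     s \<in> states (guess_wfa D f S) \<and> a \<in> S \<and> s' \<in> states (guess_wfa D f S) \<and>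
     (if psnd s' \<noteq> 0 \<and> f (psnd s' - 1) = a
      then (pfst s, psnd s' - 1, c, pfst s') \<in> delta D else c = Infty)"
  "s \<in> final (guess_wfa D f S) \<longleftrightarrow> s \<in> states (guess_wfa D f S) \<and> pfst s \<in> final D"
  by (auto simp: guess_wfa_def Let_def)

text \<open>Recording the guessed letter in the target makes the weight unique: otherwise two
  letters of \<open>D\<close> with the same image under \<open>f\<close> could join the same states
  with different weights.\<close>

lemma is_wfa_guess_wfa:
  assumes D: "is_wfa D" and "finite S"
  shows "is_wfa (guess_wfa D f S)"
  unfolding is_wfa_def
proof (intro conjI ballI)
  have "finite (states D)" "finite (insert 0 (Suc ` alphabet D))"
    using D by (auto simp: is_wfa_def)
  from finite_prod_decode[OF this] show "finite (states (guess_wfa D f S))"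
    by (simp add: guess_wfa_def Let_def)
  show "finite (alphabet (guess_wfa D f S))" using assms by (simp add: guess_wfa_sel)
  show "init (guess_wfa D f S) \<in> states (guess_wfa D f S)"
    using D by (simp add: guess_wfa_sel is_wfa_def)
  show "final (guess_wfa D f S) \<subseteq> states (guess_wfa D f S)"
    "delta (guess_wfa D f S) \<subseteq> states (guess_wfa D f S) \<times> alphabet (guess_wfa D f S) \<times> UNIV \<times>
       states (guess_wfa D f S)"
    by (auto simp: guess_wfa_sel(2,4,5))
next
  fix s s' a assume "s \<in> states (guess_wfa D f S)" "s' \<in> states (guess_wfa D f S)"
    "a \<in> alphabet (guess_wfa D f S)"
  moreover from calculation have "\<exists>!c. (pfst s, psnd s' - 1, c, pfst s') \<in> delta D"
    if "psnd s' \<noteq> 0"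
  proof -
    have "pfst s \<in> states D" "pfst s' \<in> states D" "psnd s' - 1 \<in> alphabet D"
      using calculation that by (auto simp: guess_wfa_sel)
    then show ?thesis using D unfolding is_wfa_def by blast
  qed
  ultimately show "\<exists>!c. (s, a, c, s') \<in> delta (guess_wfa D f S)"
    by (cases "psnd s' \<noteq> 0 \<and> f (psnd s' - 1) = a") (auto simp: guess_wfa_sel(2,4))
qed

lemma accepted_weights_guess_wfa:
  assumes D: "is_wfa D" and f: "f ` alphabet D \<subseteq> S" and "s \<in> states (guess_wfa D f S)"
  shows "accepted_weights (guess_wfa D f S) s w =
    (\<Union>W\<in>{W. map f W = w}. accepted_weights D (pfst s) W)"
  using assms(3)
proof (induction w arbitrary: s)
  case Nil
  then show ?case by (auto simp: accepted_weights_Nil guess_wfa_sel(5))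
next
  case (Cons a w)
  let ?U = "guess_wfa D f S"
  have "m \<in> accepted_weights ?U s (a # w) \<longleftrightarrow>
      (\<exists>W. map f W = a # w \<and> m \<in> accepted_weights D (pfst s) W)" for m
  proof
    assume "m \<in> accepted_weights ?U s (a # w)"
    then obtain c k s' where d: "(s, a, Fin c, s') \<in> delta ?U"
        and k: "k \<in> accepted_weights ?U s' w" and m: "m = c + k"
      by (auto simp: accepted_weights_Cons)
    have s': "s' \<in> states ?U" and l: "f (psnd s' - 1) = a"
        and dD: "(pfst s, psnd s' - 1, Fin c, pfst s') \<in> delta D"
      using d by (auto simp: guess_wfa_sel(4) split: if_splits)
    obtain W where "map f W = w" "k \<in> accepted_weights D (pfst s') W"
      using k unfolding Cons.IH[OF s'] by auto
    then have "map f ((psnd s' - 1) # W) = a # w"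
        "m \<in> accepted_weights D (pfst s) ((psnd s' - 1) # W)"
      using l dD m unfolding accepted_weights_Cons by auto
    then show "\<exists>W. map f W = a # w \<and> m \<in> accepted_weights D (pfst s) W"
      by (intro exI conjI)
  next
    assume "\<exists>W. map f W = a # w \<and> m \<in> accepted_weights D (pfst s) W"
    then obtain l W where a: "f l = a" and w: "map f W = w"
        and "m \<in> accepted_weights D (pfst s) (l # W)"
      by (auto simp: map_eq_Cons_conv)
    then obtain c k q where d: "(pfst s, l, Fin c, q) \<in> delta D"
        and k: "k \<in> accepted_weights D q W" and m: "m = c + k"
      by (auto simp: accepted_weights_Cons)
    define s' where "s' = prod_encode (q, Suc l)"
    have s': "s' \<in> states ?U" using delta_subset[OF D d] by (simp add: guess_wfa_sel s'_def)
    have "a \<in> S" using delta_subset[OF D d] a f by auto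
    then have "(s, a, Fin c, s') \<in> delta ?U"
      using d s' Cons.prems a by (simp add: guess_wfa_sel(4)) (simp add: s'_def)
    moreover have "k \<in> accepted_weights ?U s' w"
      unfolding Cons.IH[OF s'] using w k by (auto simp: s'_def)
    ultimately show "m \<in> accepted_weights ?U s (a # w)" unfolding accepted_weights_Cons m by blast
  qed
  then show ?case by (intro set_eqI) (simp only: UN_iff Bex_def mem_Collect_eq)
qed

definition guessed_letters :: "(nat, nat) transition list \<Rightarrow> nat list" where
  "guessed_letters \<rho> = map (\<lambda>(s, a, c, s'). psnd s' - 1) \<rho>"

lemma run_guess_wfa:
  assumes "is_run (guess_wfa D f S) s w \<rho> q"
  shows "map f (guessed_letters \<rho>) = w \<and> (\<exists>k. path D (pfst s) (guessed_letters \<rho>) k (pfst q))"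
  using assms
proof (induction w arbitrary: s \<rho>)
  case Nil
  then show ?case by (simp add: is_run_Nil_iff guessed_letters_def)
next
  case (Cons a w)
  then obtain c r \<rho>' where \<rho>: "\<rho> = (s, a, Fin c, r) # \<rho>'"
      and d: "(s, a, Fin c, r) \<in> delta (guess_wfa D f S)"
      and r: "is_run (guess_wfa D f S) r w \<rho>' q"
    by (auto simp: is_run_Cons_iff)
  have "f (psnd r - 1) = a" "(pfst s, psnd r - 1, Fin c, pfst r) \<in> delta D"
    using d by (auto simp: guess_wfa_sel(4) split: if_splits)
  then show ?case using Cons.IH[OF r] by (auto simp: \<rho> guessed_letters_def path_Cons)
qed

lemma deterministicD:
  assumes "is_wfa D" "deterministic D" "(p, a, Fin c, q) \<in> delta D" "(p, a, Fin c', q') \<in> delta D"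
  shows "c = c' \<and> q = q'"
proof -
  have "\<exists>\<^sub>\<le>\<^sub>1t. t \<in> delta D \<and> (\<exists>c q. t = (p, a, c, q) \<and> c \<noteq> Infty)"
    using assms(2) delta_subset[OF assms(1,3)] by (simp add: deterministic_def)
  then have "(p, a, Fin c, q) = (p, a, Fin c', q')"
    using assms(3,4) by (elim Uniq_D) auto
  then show ?thesis by simp
qed

text \<open>The letters determine the run of \<open>D\<close> by determinism, and they are also the
  second components of the states entered.\<close>

lemma run_guess_wfa_unique:
  assumes D: "is_wfa D" "deterministic D"
    and "is_run (guess_wfa D f S) s w \<rho> q" "is_run (guess_wfa D f S) s w \<rho>' q'"
    and "guessed_letters \<rho> = guessed_letters \<rho>'"
  shows "\<rho> = \<rho>'"
  using assms(3-)
proof (induction w arbitrary: s \<rho> \<rho>')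
  case Nil
  then show ?case by (simp add: is_run_Nil_iff)
next
  case (Cons a w)
  let ?U = "guess_wfa D f S"
  obtain c r \<sigma> where \<rho>: "\<rho> = (s, a, Fin c, r) # \<sigma>" "(s, a, Fin c, r) \<in> delta ?U"
      "is_run ?U r w \<sigma> q"
    using Cons.prems by (auto simp: is_run_Cons_iff)
  obtain c' r' \<sigma>' where \<rho>': "\<rho>' = (s, a, Fin c', r') # \<sigma>'" "(s, a, Fin c', r') \<in> delta ?U"
      "is_run ?U r' w \<sigma>' q'"
    using Cons.prems by (auto simp: is_run_Cons_iff)
  have d: "psnd r \<noteq> 0" "(pfst s, psnd r - 1, Fin c, pfst r) \<in> delta D"
      "psnd r' \<noteq> 0" "(pfst s, psnd r' - 1, Fin c', pfst r') \<in> delta D"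
    using \<rho>(2) \<rho>'(2) by (auto simp: guess_wfa_sel(4) split: if_splits)
  have l: "psnd r - 1 = psnd r' - 1" "guessed_letters \<sigma> = guessed_letters \<sigma>'"
    using Cons.prems(3) by (simp_all add: \<rho>(1) \<rho>'(1) guessed_letters_def)
  have "c = c'" "pfst r = pfst r'" using deterministicD[OF D d(2)] d(4) l(1) by auto
  moreover have "psnd r = psnd r'" using d(1,3) l(1) by simp
  ultimately have "c = c'" "r = r'" by (metis prod_decode_eq prod_eqI)+
  then show ?case using Cons.IH[OF \<rho>(3)] \<rho>'(3) l(2) by (simp add: \<rho>(1) \<rho>'(1))
qed

text \<open>Two accepting runs on \<open>w\<close> guess words accepted by \<open>D\<close> with the
  same image \<open>w\<close>. Injectivity identifies these words, and then the runs
  coincide.\<close>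

lemma unambiguous_guess_wfa:
  assumes D: "is_wfa D" "deterministic D"
    and inj: "inj_on (map f) {W. accepted_weights D (init D) W \<noteq> {}}"
  shows "unambiguous (guess_wfa D f S)"
  unfolding unambiguous_def
proof (intro ballI Uniq_I)
  fix w \<rho> \<rho>'
  let ?U = "guess_wfa D f S"
  have mem: "guessed_letters \<tau> \<in> {W. accepted_weights D (init D) W \<noteq> {}} \<and>
      map f (guessed_letters \<tau>) = w" if "accepting_run ?U w \<tau>" for \<tau>
  proof -
    obtain q where "is_run ?U (init ?U) w \<tau> q" "q \<in> final ?U"
      using \<open>accepting_run ?U w \<tau>\<close> by (auto simp: accepting_run_def)
    then show ?thesis using run_guess_wfa[of D f S "init ?U" w \<tau> q]
      by (auto simp: guess_wfa_sel(3,5) accepted_weights_def)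
  qed
  assume "accepting_run ?U w \<rho>" "accepting_run ?U w \<rho>'"
  then have "guessed_letters \<rho> = guessed_letters \<rho>'"
    using mem inj_onD[OF inj] by metis
  then show "\<rho> = \<rho>'"
    using \<open>accepting_run ?U w \<rho>\<close> \<open>accepting_run ?U w \<rho>'\<close> run_guess_wfa_unique[OF D]
    unfolding accepting_run_def by blast
qed

lemma unambiguisable_if_determinisable_lookahead_wfa:
  assumes A: "is_wfa A" and "determinisable (lookahead_wfa A)"
  shows "unambiguisable A"
proof -
  let ?B = "lookahead_wfa A"
  obtain D :: "(nat, nat) wfa" where D: "is_wfa D" "deterministic D"
      and alph: "alphabet ?B = alphabet D"
      and val: "\<And>W. W \<in> lists (alphabet ?B) \<Longrightarrow> wfa_value ?B W = wfa_value D W"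
    using assms(2) by (auto simp: determinisable_def equivalent_def)
  have ann: "W = annotate A (map pfst W)" if "accepted_weights D (init D) W \<noteq> {}" for W
  proof -
    have "W \<in> lists (alphabet ?B)"
      using that accepted_weights_lists[OF D(1)] by (auto simp: alph)
    then have "accepted_weights ?B (init ?B) W \<noteq> {}"
      using val that by (metis wfa_value_Infty_iff)
    then show ?thesis
      unfolding accepted_weights_init_lookahead_wfa[OF A] by (auto split: if_splits)
  qed
  define U where "U = guess_wfa D pfst (alphabet A)"
  have U: "is_wfa U"
    unfolding U_def using A by (intro is_wfa_guess_wfa D) (simp add: is_wfa_def)
  have "unambiguous U"
    unfolding U_def
  proof (intro unambiguous_guess_wfa D inj_on_inverseI)
    \<comment> \<open>Annotating is a left inverse of erasing the annotations on the words accepted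
      by \<open>D\<close>.\<close>
    show "annotate A (map pfst W) = W" if "W \<in> {W. accepted_weights D (init D) W \<noteq> {}}" for W
      using ann that by simp
  qed
  moreover have "equivalent A U"
    unfolding equivalent_def
  proof (intro conjI ballI)
    show "alphabet A = alphabet U" by (simp add: U_def guess_wfa_sel)
    fix w assume w: "w \<in> lists (alphabet A)"
    have "pfst ` alphabet D \<subseteq> alphabet A"
      unfolding alph[symmetric] by (auto simp: lookahead_wfa_sel)
    moreover have "init U \<in> states U" using U by (simp add: is_wfa_def)
    ultimately have "accepted_weights U (init U) w =
        (\<Union>W\<in>{W. map pfst W = w}. accepted_weights D (init D) W)"
      unfolding U_def by (subst accepted_weights_guess_wfa[OF D(1)]) (simp_all add: guess_wfa_sel)
    also have "\<dots> = accepted_weights D (init D) (annotate A w)"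
    proof (intro equalityI subsetI)
      fix k assume "k \<in> (\<Union>W\<in>{W. map pfst W = w}. accepted_weights D (init D) W)"
      then obtain W where W: "map pfst W = w" "k \<in> accepted_weights D (init D) W" by blast
      then have "annotate A w = W" using ann[of W] by fastforce
      then show "k \<in> accepted_weights D (init D) (annotate A w)" using W by simp
    qed (rule UN_I[of "annotate A w"], simp_all)
    finally have "wfa_value U w = wfa_value D (annotate A w)" unfolding wfa_value_eq by simp
    also have "\<dots> = wfa_value ?B (annotate A w)"
      using val annotate_in_lists[OF A w] by simp
    also have "\<dots> = wfa_value A w"
      unfolding wfa_value_eq accepted_weights_init_lookahead_wfa[OF A] by simp
    finally show "wfa_value A w = wfa_value U w" ..
  qed
  ultimately show ?thesis using U unfolding unambiguisable_def by blast
qed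

section \<open>Finitely many residuals up to shifts\<close>

lemma not_Infty_iff: "c \<noteq> Infty \<longleftrightarrow> (\<exists>k. c = Fin k)"
  by (cases c) auto

text \<open>\<open>N\<close> is an offset of the shift class minus the shift to its representative.
  The offset is the value at the representative, if finite; this forces \<open>N u = k\<close>
  whenever \<open>g u = Fin k\<close>. The demand \<open>N [] = 0\<close> is compatible because
  \<open>g []\<close> is \<open>Fin 0\<close> or \<open>Infty\<close>.\<close>

lemma normalisation_exists:
  fixes g :: "'a list \<Rightarrow> zinf" and L :: "'a list set"
  assumes nil: "g [] \<in> {Fin 0, Infty}" "[] \<in> L"
  obtains N :: "'a list \<Rightarrow> int" where
    "\<And>u k. g u = Fin k \<Longrightarrow> N u = k"
    "\<exists>w\<in>L. g w \<noteq> Infty \<Longrightarrow> N [] = 0"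
    "\<And>u u' c. u \<in> L \<Longrightarrow> u' \<in> L \<Longrightarrow> \<forall>w\<in>L. \<forall>k. g (u @ w) = Fin k \<longleftrightarrow> g (u' @ w) = Fin (k + c) \<Longrightarrow>
       \<forall>w\<in>L. \<forall>k. g (u @ w) = Fin (N u + k) \<longleftrightarrow> g (u' @ w) = Fin (N u' + k)"
proof -
  define R where "R u u' c \<longleftrightarrow> (\<forall>w\<in>L. \<forall>k. g (u @ w) = Fin k \<longleftrightarrow> g (u' @ w) = Fin (k + c))"
    for u u' c
  have R_refl: "R u u 0" for u by (simp add: R_def)
  have R_sym: "R u' u (- c)" if "R u u' c" for u u' c
    unfolding R_def
  proof (intro ballI allI)
    fix w k assume "w \<in> L"
    then have "g (u @ w) = Fin (k + - c) \<longleftrightarrow> g (u' @ w) = Fin (k + - c + c)"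
      using that unfolding R_def by blast
    then show "g (u' @ w) = Fin k \<longleftrightarrow> g (u @ w) = Fin (k + - c)" by simp
  qed
  have R_trans: "R u u'' (c + c')" if "R u u' c" "R u' u'' c'" for u u' u'' c c'
    using that unfolding R_def by (simp add: add.assoc)
  define cls where "cls u = {v. \<exists>c. R u v c}" for u
  \<comment> \<open>The empty word has to represent its own class, so that no other offset
    interferes with \<open>N [] = 0\<close>.\<close>
  define rep where "rep u = (if [] \<in> cls u then [] else SOME v. v \<in> cls u)" for u
  define shift where "shift u = (SOME c. R u (rep u) c)" for u
  define N where "N u = (if g (rep u) = Infty then 0 else int_of (g (rep u))) - shift u" for u
  have "\<exists>c. R u (rep u) c" for u
  proof -
    have "u \<in> cls u" using R_refl by (auto simp: cls_def)
    then have "rep u \<in> cls u" unfolding rep_def by (auto intro: someI)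
    then show ?thesis by (simp add: cls_def)
  qed
  then have R: "R u (rep u) (shift u)" for u
    unfolding shift_def by (rule someI_ex)
  have cls_eq: "cls u = cls u'" if "R u u' c" for u u' c
    unfolding cls_def using that R_sym R_trans by blast
  then have rep_eq: "rep u = rep u'" if "R u u' c" for u u' c
    using that unfolding rep_def by metis
  show thesis
  proof
    show "N u = k" if "g u = Fin k" for u k
    proof -
      have "g (rep u) = Fin (k + shift u)" using R[of u] nil(2) that unfolding R_def by force
      then show ?thesis by (simp add: N_def)
    qed
    show "N [] = 0" if nonempty: "\<exists>w\<in>L. g w \<noteq> Infty"
    proof -
      obtain w k where w: "w \<in> L" "g w = Fin k" using nonempty by (auto simp: not_Infty_iff)
      have "[] \<in> cls []" using R_refl by (auto simp: cls_def)
      then have rep: "rep [] = []" by (simp add: rep_def)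
      then have "R [] [] (shift [])" using R[of "[]"] by simp
      then have "g ([] @ w) = Fin k \<longleftrightarrow> g ([] @ w) = Fin (k + shift [])"
        using w(1) unfolding R_def by blast
      \<comment> \<open>A residual with a finite value cannot equal itself after a nonzero shift.
        For one that is constantly \<open>Infty\<close> every shift is possible, hence the
        assumption.\<close>
      then have "shift [] = 0" using w(2) by simp
      then show ?thesis using nil(1) rep by (auto simp: N_def)
    qed
    show "\<forall>w\<in>L. \<forall>k. g (u @ w) = Fin (N u + k) \<longleftrightarrow> g (u' @ w) = Fin (N u' + k)"
      if "u \<in> L" "u' \<in> L" "\<forall>w\<in>L. \<forall>k. g (u @ w) = Fin k \<longleftrightarrow> g (u' @ w) = Fin (k + c)" for u u' c
    proof -
      have "rep u = rep u'" using rep_eq that(3) unfolding R_def[symmetric] by blast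
      moreover from this have "N u + shift u = N u' + shift u'" by (simp add: N_def)
      moreover have "g (v @ w) = Fin (N v + k) \<longleftrightarrow> g (rep v @ w) = Fin (N v + shift v + k)"
        if "w \<in> L" for v w k
        using R[of v] that unfolding R_def by (metis add.assoc add.commute)
      ultimately show ?thesis by simp
    qed
  qed
qed

text \<open>
  The Myhill--Nerode construction. Since a run has neither initial nor final weights, the potential
  \<open>N u\<close> collected along a prefix \<open>u\<close> has to be \<open>0\<close> at the empty word and \<open>g u\<close> if this is finite.
\<close>

lemma deterministic_wfa_if_finite_residuals:
  fixes g :: "'a list \<Rightarrow> zinf" and \<kappa> :: "'a list \<Rightarrow> 's"
  assumes "finite \<Gamma>" and nil: "g [] \<in> {Fin 0, Infty}" and fin: "finite (\<kappa> ` lists \<Gamma>)"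
    and shift: "\<And>u u'. u \<in> lists \<Gamma> \<Longrightarrow> u' \<in> lists \<Gamma> \<Longrightarrow> \<kappa> u = \<kappa> u' \<Longrightarrow>
      \<exists>c. \<forall>w\<in>lists \<Gamma>. \<forall>k. g (u @ w) = Fin k \<longleftrightarrow> g (u' @ w) = Fin (k + c)"
  shows "\<exists>D :: (nat, 'a) wfa. is_wfa D \<and> deterministic D \<and> alphabet D = \<Gamma> \<and>
    (\<forall>w\<in>lists \<Gamma>. wfa_value D w = g w)"
proof -
  let ?L = "lists \<Gamma>"
  obtain N where N_fin: "\<And>u k. g u = Fin k \<Longrightarrow> N u = k"
    and N_nil: "\<exists>w\<in>?L. g w \<noteq> Infty \<Longrightarrow> N [] = 0"
    and N_shift: "\<And>u u' c. u \<in> ?L \<Longrightarrow> u' \<in> ?L \<Longrightarrow>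
       \<forall>w\<in>?L. \<forall>k. g (u @ w) = Fin k \<longleftrightarrow> g (u' @ w) = Fin (k + c) \<Longrightarrow>
       \<forall>w\<in>?L. \<forall>k. g (u @ w) = Fin (N u + k) \<longleftrightarrow> g (u' @ w) = Fin (N u' + k)"
    by (rule normalisation_exists[of g ?L]) (use nil in auto)
  \<comment> \<open>Subtracting the potential turns equality up to a shift into plain equality, so
    these sets can serve as states.\<close>
  define res where "res u = {(w, k). w \<in> ?L \<and> g (u @ w) = Fin (N u + k)}" for u
  \<comment> \<open>On a prefix without finite continuation \<open>N\<close> carries no information.
    Weight differences are well defined only for live targets, and only these receive finite
    transitions.\<close>
  define alive where "alive u \<longleftrightarrow> (\<exists>w\<in>?L. \<exists>k. g (u @ w) = Fin k)" for u
  have res_eqI: "res u = res u'"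
    if "u \<in> ?L" "u' \<in> ?L" "\<forall>w\<in>?L. \<forall>k. g (u @ w) = Fin k \<longleftrightarrow> g (u' @ w) = Fin (k + c)" for u u' c
    using N_shift[OF that] unfolding res_def by auto
  have res_eqD: "g (u @ w) = Fin k \<longleftrightarrow> g (u' @ w) = Fin (k + (N u' - N u))"
    if "res u = res u'" "w \<in> ?L" for u u' w k
  proof -
    have "(w, k - N u) \<in> res u \<longleftrightarrow> (w, k - N u) \<in> res u'" using that(1) by simp
    then show ?thesis using that(2) by (simp add: res_def algebra_simps)
  qed
  have res_snoc: "res (u @ [a]) = res (u' @ [a])"
    if "u \<in> ?L" "u' \<in> ?L" "a \<in> \<Gamma>" "res u = res u'" for u u' a
    by (rule res_eqI[where c = "N u' - N u"]) (use that res_eqD[of u u' "a # _"] in auto)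
  have alive_eq: "alive u \<longleftrightarrow> alive u'" if "res u = res u'" for u u'
    using res_eqD[OF that] res_eqD[OF that[symmetric]] unfolding alive_def by blast
  have N_diff: "N (u @ [a]) - N u = N (u' @ [a]) - N u'"
    if "u \<in> ?L" "u' \<in> ?L" "a \<in> \<Gamma>" "res u = res u'" and alive: "alive (u @ [a])" for u u' a
  proof -
    obtain w k where w: "w \<in> ?L" "g ((u @ [a]) @ w) = Fin k"
      using alive unfolding alive_def by blast
    have "g ((u' @ [a]) @ w) = Fin (k + (N (u' @ [a]) - N (u @ [a])))"
      using res_eqD[OF res_snoc[OF that(1-4)] w(1)] w(2) by blast
    moreover have "g (u' @ (a # w)) = Fin (k + (N u' - N u))"
      using res_eqD[OF that(4), of "a # w"] that(3) w by auto
    ultimately show ?thesis by simp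
  qed
  have "finite (res ` ?L)"
  proof -
    \<comment> \<open>\<open>\<kappa>\<close> need not respect appending letters. It only bounds the
      number of residuals, and these do respect it.\<close>
    have "\<exists>h. \<forall>u\<in>?L. res u = h (\<kappa> u)"
    proof (intro exI ballI)
      fix u assume u: "u \<in> ?L"
      let ?v = "SOME v. v \<in> ?L \<and> \<kappa> v = \<kappa> u"
      have "?v \<in> ?L \<and> \<kappa> ?v = \<kappa> u" by (rule someI[of _ u]) (use u in simp)
      then show "res u = (\<lambda>x. res (SOME v. v \<in> ?L \<and> \<kappa> v = x)) (\<kappa> u)"
        using shift[of u ?v] res_eqI[of u ?v] u by auto
    qed
    then obtain h where "\<forall>u\<in>?L. res u = h (\<kappa> u)" by blast
    then have "res ` ?L \<subseteq> h ` \<kappa> ` ?L" by auto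
    then show ?thesis using fin by (meson finite_imageI finite_subset)
  qed
  then obtain e :: "_ \<Rightarrow> nat" where e: "inj_on e (res ` ?L)"
    using finite_imp_inj_to_nat_seg by blast
  define st where "st u = e (res u)" for u
  have st_eq: "st u = st u' \<longleftrightarrow> res u = res u'" if "u \<in> ?L" "u' \<in> ?L" for u u'
    using that unfolding st_def by (auto dest: inj_onD[OF e])
  \<comment> \<open>The weight of a transition is the increase of the potential, so the weights
    along a path telescope.\<close>
  define T where "T = {(st u, a, Fin (N (u @ [a]) - N u), st (u @ [a])) |u a.
    u \<in> ?L \<and> a \<in> \<Gamma> \<and> alive (u @ [a])}"
  have T_iff: "(st u, a, Fin c, q) \<in> T \<longleftrightarrow>
      a \<in> \<Gamma> \<and> alive (u @ [a]) \<and> c = N (u @ [a]) - N u \<and> q = st (u @ [a])"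
    if u: "u \<in> ?L" for u a c q
  proof
    assume "(st u, a, Fin c, q) \<in> T"
    then obtain u' where u': "u' \<in> ?L" "st u = st u'" and a: "a \<in> \<Gamma>" "alive (u' @ [a])"
        and cq: "c = N (u' @ [a]) - N u'" "q = st (u' @ [a])"
      unfolding T_def by blast
    have r: "res u' = res u" using u' u st_eq by simp
    show "a \<in> \<Gamma> \<and> alive (u @ [a]) \<and> c = N (u @ [a]) - N u \<and> q = st (u @ [a])"
      using a cq alive_eq[OF res_snoc[OF u'(1) u a(1) r]] N_diff[OF u'(1) u a(1) r a(2)]
        res_snoc[OF u'(1) u a(1) r] by (simp add: st_def)
  qed (use u in \<open>auto simp: T_def\<close>)
  define D where "D = \<lparr>states = st ` ?L, alphabet = \<Gamma>, init = st [],
    delta = T \<union> {(p, a, Infty, q) |p a q. p \<in> st ` ?L \<and> a \<in> \<Gamma> \<and> q \<in> st ` ?L \<and>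
      (\<forall>k. (p, a, Fin k, q) \<notin> T)},
    final = st ` {u \<in> ?L. g u \<noteq> Infty}\<rparr>"
  have D_sel: "states D = st ` ?L" "alphabet D = \<Gamma>" "init D = st []"
      "final D = st ` {u \<in> ?L. g u \<noteq> Infty}"
      "(p, a, Fin k, q) \<in> delta D \<longleftrightarrow> (p, a, Fin k, q) \<in> T"
      "(p, a, Infty, q) \<in> delta D \<longleftrightarrow> p \<in> st ` ?L \<and> a \<in> \<Gamma> \<and> q \<in> st ` ?L \<and>
         (\<forall>k. (p, a, Fin k, q) \<notin> T)" for p a k q
    by (auto simp: D_def T_def)
  have T_fun: "c = c' \<and> q = q'" if T: "(p, a, Fin c, q) \<in> T" "(p, a, Fin c', q') \<in> T" for p a c c' q q'
  proof -
    obtain u where u: "u \<in> ?L" "p = st u" using T by (auto simp: T_def)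
    show ?thesis using T unfolding u(2) T_iff[OF u(1)] by simp
  qed
  have T_sub: "p \<in> st ` ?L \<and> a \<in> \<Gamma> \<and> q \<in> st ` ?L" if "(p, a, c, q) \<in> T" for p a c q
    using that unfolding T_def by (auto intro!: imageI)
  have wfa: "is_wfa D"
    unfolding is_wfa_def
  proof (intro conjI ballI)
    have "states D = e ` res ` ?L" unfolding D_sel st_def by (simp add: image_image)
    then show "finite (states D)" using \<open>finite (res ` ?L)\<close> by simp
    show "delta D \<subseteq> states D \<times> alphabet D \<times> UNIV \<times> states D"
    proof
      fix t assume t: "t \<in> delta D"
      obtain p a c q where "t = (p, a, c, q)" by (cases t)
      then show "t \<in> states D \<times> alphabet D \<times> UNIV \<times> states D"
        using t T_sub by (cases c) (simp_all add: D_sel)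
    qed
    fix p q a assume "p \<in> states D" "q \<in> states D" "a \<in> alphabet D"
    then have Infty: "(p, a, Infty, q) \<in> delta D \<longleftrightarrow> (\<forall>k. (p, a, Fin k, q) \<notin> T)"
      by (simp add: D_sel)
    show "\<exists>!c. (p, a, c, q) \<in> delta D"
    proof (cases "\<exists>k. (p, a, Fin k, q) \<in> T")
      case True
      then obtain k where k: "(p, a, Fin k, q) \<in> T" by blast
      show ?thesis
      proof (rule ex1I[of _ "Fin k"])
        show "(p, a, Fin k, q) \<in> delta D" using k by (simp add: D_sel)
        show "c = Fin k" if "(p, a, c, q) \<in> delta D" for c
          using that k T_fun Infty by (cases c) (auto simp: D_sel(5))
      qed
    next
      case False
      show ?thesis
      proof (rule ex1I[of _ Infty])
        show "(p, a, Infty, q) \<in> delta D" using False Infty by simp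
        show "c = Infty" if "(p, a, c, q) \<in> delta D" for c
          using that False by (cases c) (auto simp: D_sel(5))
      qed
    qed
  qed (use assms(1) in \<open>auto simp: D_sel(1-4)\<close>)
  have det: "deterministic D"
    unfolding deterministic_def
  proof (intro ballI Uniq_I)
    fix p a t t'
    assume "t \<in> delta D \<and> (\<exists>c q. t = (p, a, c, q) \<and> c \<noteq> Infty)"
      "t' \<in> delta D \<and> (\<exists>c q. t' = (p, a, c, q) \<and> c \<noteq> Infty)"
    then obtain k q k' q' where "t = (p, a, Fin k, q)" "t' = (p, a, Fin k', q')"
        "t \<in> delta D" "t' \<in> delta D"
      by (auto simp: not_Infty_iff)
    then show "t = t'" using T_fun by (simp add: D_sel(5))
  qed
  have alive_append: "alive u" if alive: "alive (u @ v)" and "v \<in> ?L" for u v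
  proof -
    obtain w k where "w \<in> ?L" "g (u @ v @ w) = Fin k"
      using alive unfolding alive_def by auto
    then show ?thesis using that(2) unfolding alive_def
      by (intro bexI[of _ "v @ w"] exI[of _ k]) auto
  qed
  \<comment> \<open>Live prefixes are closed under shortening, so a live end point keeps the whole
    path live. The empty path uses no transition and needs no such condition.\<close>
  have path: "path D (st v) u k q \<longleftrightarrow>
      (u = [] \<or> alive (v @ u)) \<and> q = st (v @ u) \<and> k = N (v @ u) - N v"
    if "v \<in> ?L" "u \<in> ?L" for u v k q
    using that
  proof (induction u arbitrary: v k)
    case (Cons a u)
    then have IH: "path D (st (v @ [a])) u k q \<longleftrightarrow> (u = [] \<or> alive (v @ a # u)) \<and>
        q = st (v @ a # u) \<and> k = N (v @ a # u) - N (v @ [a])" for k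
      using Cons.IH[of "v @ [a]" k] by simp
    have "alive (v @ [a])" if "alive (v @ a # u)"
      using alive_append[of "v @ [a]" u] that Cons.prems by simp
    then show ?case unfolding path_Cons D_sel(5) T_iff[OF Cons.prems(1)] using IH Cons.prems
      by (cases "u = []") auto
  qed auto
  have final: "st u \<in> final D \<longleftrightarrow> g u \<noteq> Infty" if "u \<in> ?L" for u
  proof
    assume "st u \<in> final D"
    then obtain u' where u': "u' \<in> ?L" "st u = st u'" "g u' \<noteq> Infty" unfolding D_sel by auto
    then obtain k where "g u' = Fin k" by (auto simp: not_Infty_iff)
    then show "g u \<noteq> Infty" using res_eqD[of u' u "[]" k] u' st_eq that by simp
  qed (use that in \<open>auto simp: D_sel\<close>)
  have "wfa_value D u = g u" if u: "u \<in> ?L" for u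
  proof (cases "g u")
    case Infty
    then have "accepted_weights D (init D) u = {}"
      using path[of "[]" u] u final[OF u] by (auto simp: accepted_weights_def D_sel(3))
    then show ?thesis using Infty by (simp add: wfa_value_eq)
  next
    case (Fin k)
    have "g u \<noteq> Infty" using Fin by simp
    then have "N [] = 0" using N_nil u by blast
    moreover have "alive u" using Fin unfolding alive_def by (intro bexI[of _ "[]"] exI[of _ k]) auto
    moreover have "N u = k" using Fin by (rule N_fin)
    ultimately have "accepted_weights D (init D) u = {k}"
      using path[of "[]" u] u final[OF u] Fin by (auto simp: accepted_weights_def D_sel(3))
    then show ?thesis using Fin by (simp add: wfa_value_eq)
  qed
  then show ?thesis using wfa det D_sel(2) by blast
qed

section \<open>From unambiguous to deterministic automata\<close>

lemma path_weight_bound: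
  assumes "is_wfa A"
  obtains M :: int where "0 \<le> M" "\<And>p w k q. path A p w k q \<Longrightarrow> \<bar>k\<bar> \<le> M * int (length w)"
proof -
  define M where "M = Max (insert 0 ((\<lambda>(p, a, c, q). \<bar>int_of c\<bar>) ` delta A))"
  have fin: "finite (insert 0 ((\<lambda>(p, a, c, q). \<bar>int_of c\<bar>) ` delta A))"
    using finite_delta[OF assms] by simp
  have le: "\<bar>c\<bar> \<le> M" if "(p, a, Fin c, q) \<in> delta A" for p a c q
    unfolding M_def by (rule Max_ge[OF fin]) (use that in force)
  show thesis
  proof
    show "0 \<le> M" unfolding M_def by (rule Max_ge[OF fin]) simp
    show "\<bar>k\<bar> \<le> M * int (length w)" if "path A p w k q" for p w k q
      using that
    proof (induction w arbitrary: p k)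
      case (Cons a w)
      then obtain c r k' where "(p, a, Fin c, r) \<in> delta A" "path A r w k' q" "k = c + k'"
        by (auto simp: path_Cons)
      then show ?case using le[of p a c r] Cons.IH[of r k'] by (simp add: algebra_simps)
    qed simp
  qed
qed

text \<open>
  An optimal run on \<open>v @ w\<close> passes through a state from which \<open>w'\<close> is accepted as well.
\<close>

lemma wfa_value_change_suffix:
  assumes A: "is_wfa A"
  obtains M :: int where "0 \<le> M"
    "\<And>v w w' k k'. accepting_states A w = accepting_states A w' \<Longrightarrow>
       wfa_value A (v @ w) = Fin k \<Longrightarrow> wfa_value A (v @ w') = Fin k' \<Longrightarrow>
       k' \<le> k + M * int (length w) + M * int (length w')"
proof -
  obtain M where M: "0 \<le> M" "\<And>p w k q. path A p w k q \<Longrightarrow> \<bar>k\<bar> \<le> M * int (length w)"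
    using path_weight_bound[OF A] by blast
  show thesis
  proof
    fix v w w' k k'
    assume eq: "accepting_states A w = accepting_states A w'"
      and k: "wfa_value A (v @ w) = Fin k" and k': "wfa_value A (v @ w') = Fin k'"
    obtain i p j where v: "path A (init A) v i p" and j: "j \<in> accepted_weights A p w" "k = i + j"
      using k by (auto simp: wfa_value_eq_Fin_iff[OF A] accepted_weights_append)
    have "p \<in> accepting_states A w'" unfolding eq[symmetric] using j by (auto simp: accepting_states_def)
    then obtain j' where j': "j' \<in> accepted_weights A p w'" by (auto simp: accepting_states_def)
    then have "i + j' \<in> accepted_weights A (init A) (v @ w')"
      using v by (intro accepted_weights_appendI)
    then have "k' \<le> i + j'" using k' by (simp add: wfa_value_eq_Fin_iff[OF A])
    moreover have "\<bar>j\<bar> \<le> M * int (length w)" "\<bar>j'\<bar> \<le> M * int (length w')"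
      using M(2) j j' by (auto simp: accepted_weights_def)
    ultimately show "k' \<le> k + M * int (length w) + M * int (length w')" using j(2) by simp
  qed (rule M(1))
qed

text \<open>With at most one weight to minimise over, any accepting path yields the exact value and
  not merely an upper bound.\<close>

lemma unambiguous_wfa_value:
  assumes U: "is_wfa U" "unambiguous U"
  shows "wfa_value U w = Fin k \<longleftrightarrow> k \<in> accepted_weights U (init U) w"
proof -
  have "i = j" if ij: "i \<in> accepted_weights U (init U) w" "j \<in> accepted_weights U (init U) w" for i j
  proof -
    have "w \<in> lists (alphabet U)" using accepted_weights_lists[OF U(1)] ij by blast
    then have "\<exists>\<^sub>\<le>\<^sub>1\<rho>. accepting_run U w \<rho>" using U(2) by (simp add: unambiguous_def)
    then show ?thesis using ij unfolding accepted_weights_eq_run_weight by (auto dest: Uniq_D)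
  qed
  then show ?thesis unfolding wfa_value_eq_Fin_iff[OF U(1)] by blast
qed

text \<open>A prefix \<open>v\<close> is summarised by the weights of reaching the useful states,
  relative to a reference weight \<open>k0 v\<close>. Exactness of the weights of \<open>U\<close>
  turns the bound on values into a bound on these differences, so only finitely many summaries
  occur.\<close>

lemma finite_residuals_fixed_lookahead:
  fixes A :: "('q, 'a) wfa" and U :: "('r, 'a) wfa"
  assumes A: "is_wfa A" and U: "is_wfa U" "unambiguous U" and equiv: "equivalent A U"
  shows "\<exists>\<kappa> :: 'a list \<Rightarrow> ('r \<times> int) set. finite (\<kappa> ` lists (alphabet A)) \<and>
    (\<forall>v\<in>lists (alphabet A). \<forall>v'\<in>lists (alphabet A). \<kappa> v = \<kappa> v' \<longrightarrow>
      (\<exists>c. \<forall>w\<in>lists (alphabet A). accepting_states A w = S \<longrightarrow>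
        (\<forall>k. wfa_value A (v @ w) = Fin k \<longleftrightarrow> wfa_value A (v' @ w) = Fin (k + c))))"
proof -
  let ?L = "lists (alphabet A)"
  have val: "wfa_value A w = Fin k \<longleftrightarrow> k \<in> accepted_weights U (init U) w" if "w \<in> ?L" for w k
    using unambiguous_wfa_value[OF U] equiv that by (simp add: equivalent_def)
  obtain M where M: "0 \<le> M" "\<And>v w w' k k'. accepting_states A w = accepting_states A w' \<Longrightarrow>
       wfa_value A (v @ w) = Fin k \<Longrightarrow> wfa_value A (v @ w') = Fin k' \<Longrightarrow>
       k' \<le> k + M * int (length w) + M * int (length w')"
    using wfa_value_change_suffix[OF A] by blast
  define T where "T = {q \<in> states U. \<exists>w\<in>?L. accepting_states A w = S \<and> accepted_weights U q w \<noteq> {}}"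
  have "finite T" using U(1) by (simp add: T_def is_wfa_def)
  have "\<forall>q\<in>T. \<exists>w k. w \<in> ?L \<and> accepting_states A w = S \<and> k \<in> accepted_weights U q w"
    unfolding T_def by blast
  then obtain W K where WK: "\<And>q. q \<in> T \<Longrightarrow> W q \<in> ?L" "\<And>q. q \<in> T \<Longrightarrow> accepting_states A (W q) = S"
      "\<And>q. q \<in> T \<Longrightarrow> K q \<in> accepted_weights U q (W q)"
    by metis
  \<comment> \<open>A sum as a common bound for all members of \<open>T\<close>; unlike a maximum it
    needs no case distinction for empty \<open>T\<close>.\<close>
  define B where "B = (\<Sum>q\<in>T. \<bar>K q\<bar> + M * int (length (W q)))"
  have B: "\<bar>K q\<bar> + M * int (length (W q)) \<le> B" if "q \<in> T" for q
    unfolding B_def by (rule member_le_sum[OF that]) (use M(1) \<open>finite T\<close> in auto)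
  have bound: "i' - i \<le> 2 * B"
    if v: "v \<in> ?L" and q: "q \<in> T" "path U (init U) v i q" and q': "q' \<in> T" "path U (init U) v i' q'"
    for v q q' i i'
  proof -
    have "wfa_value A (v @ W q) = Fin (i + K q)" "wfa_value A (v @ W q') = Fin (i' + K q')"
      using accepted_weights_appendI[OF q(2) WK(3)[OF q(1)]]
        accepted_weights_appendI[OF q'(2) WK(3)[OF q'(1)]] v WK(1) q(1) q'(1)
      by (simp_all add: val)
    then have "i' + K q' \<le> i + K q + M * int (length (W q)) + M * int (length (W q'))"
      using M(2) WK(2) q(1) q'(1) by metis
    then show ?thesis using B[OF q(1)] B[OF q'(1)] by linarith
  qed
  \<comment> \<open>If no state of \<open>T\<close> is reached, \<open>k0 v\<close> is arbitrary,
    but then the set \<open>\<kappa> v\<close> is empty.\<close>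
  define k0 where "k0 v = (SOME i. \<exists>q\<in>T. path U (init U) v i q)" for v
  define \<kappa> where "\<kappa> v = {(q, i - k0 v) |q i. q \<in> T \<and> path U (init U) v i q}" for v
  have "\<kappa> v \<subseteq> T \<times> {- (2 * B)..2 * B}" if v: "v \<in> ?L" for v
  proof clarify
    fix q j assume "(q, j) \<in> \<kappa> v"
    then obtain i where i: "q \<in> T" "path U (init U) v i q" "j = i - k0 v" by (auto simp: \<kappa>_def)
    then have "\<exists>i. \<exists>q\<in>T. path U (init U) v i q" by blast
    then have "\<exists>q\<in>T. path U (init U) v (k0 v) q" unfolding k0_def by (rule someI_ex)
    then obtain q0 where "q0 \<in> T" "path U (init U) v (k0 v) q0" by blast
    then show "q \<in> T \<and> j \<in> {- (2 * B)..2 * B}"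
      using i bound[OF v, of q i q0 "k0 v"] bound[OF v, of q0 "k0 v" q i] by simp
  qed
  then have "\<kappa> ` ?L \<subseteq> Pow (T \<times> {- (2 * B)..2 * B})" by blast
  then have fin: "finite (\<kappa> ` ?L)"
    by (rule finite_subset) (use \<open>finite T\<close> in simp)
  \<comment> \<open>The state reached after \<open>v\<close> on an accepting path lies in
    \<open>T\<close>, with \<open>w\<close> as witness. Hence it is also reached on
    \<open>v'\<close>, at a weight shifted by the difference of the references, and the same
    continuation applies.\<close>
  have shift: "k + (k0 v' - k0 v) \<in> accepted_weights U (init U) (v' @ w)"
    if eq: "\<kappa> v = \<kappa> v'" and w: "w \<in> ?L" "accepting_states A w = S"
      and k: "k \<in> accepted_weights U (init U) (v @ w)" for v v' w k
  proof -
    obtain i j q where q: "path U (init U) v i q" and j: "j \<in> accepted_weights U q w" "k = i + j"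
      using k by (auto simp: accepted_weights_append)
    have "q \<in> T"
      using w j path_states(1)[OF U(1) q] U(1) unfolding T_def by (auto simp: is_wfa_def)
    then have "(q, i - k0 v) \<in> \<kappa> v'" unfolding eq[symmetric] using q by (auto simp: \<kappa>_def)
    then obtain i' where i': "path U (init U) v' i' q" "i - k0 v = i' - k0 v'" by (auto simp: \<kappa>_def)
    then have "k + (k0 v' - k0 v) = i' + j" using j(2) by simp
    then show ?thesis using accepted_weights_appendI[OF i'(1) j(1)] by simp
  qed
  show ?thesis
  proof (intro exI[of _ \<kappa>] conjI ballI impI fin)
    fix v v' assume v: "v \<in> ?L" "v' \<in> ?L" and eq: "\<kappa> v = \<kappa> v'"
    have "wfa_value A (v @ w) = Fin k \<longleftrightarrow> wfa_value A (v' @ w) = Fin (k + (k0 v' - k0 v))"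
      if "w \<in> ?L" "accepting_states A w = S" for w k
      using shift[OF eq that, of k] shift[OF eq[symmetric] that, of "k + (k0 v' - k0 v)"] v that
      by (auto simp: val)
    then show "\<exists>c. \<forall>w\<in>?L. accepting_states A w = S \<longrightarrow>
         (\<forall>k. wfa_value A (v @ w) = Fin k \<longleftrightarrow> wfa_value A (v' @ w) = Fin (k + c))"
      by blast
  qed
qed

lemma accepting_states_append_cong:
  "accepting_states A w = accepting_states A w' \<Longrightarrow>
     accepting_states A (v @ w) = accepting_states A (v @ w')"
  by (induction v) auto

lemma drop_annotate_append: "drop (length v) (annotate A (v @ w)) = annotate A w"
  by (induction v) auto

text \<open>Annotations are computed from the right, so a suffix acts on earlier letters only
  through the set of states accepting it.\<close>

lemma take_annotate_append_cong:
  assumes "accepting_states A w = accepting_states A w'"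
  shows "take (length v) (annotate A (v @ w)) = take (length v) (annotate A (v @ w'))"
  by (induction v) (simp_all add: accepting_states_append_cong[OF assms])

lemma last_take_annotate_append:
  "v \<noteq> [] \<Longrightarrow>
     psnd (last (take (length v) (annotate A (v @ w)))) = set_encode (accepting_states A w)"
  by (induction v rule: list_nonempty_induct) auto

lemma wfa_value_lookahead_wfa:
  assumes "is_wfa A"
  shows "wfa_value (lookahead_wfa A) W =
    (if W = annotate A (map pfst W) then wfa_value A (map pfst W) else Infty)"
  by (simp add: wfa_value_eq accepted_weights_init_lookahead_wfa[OF assms])

text \<open>Having one correct completion \<open>W0\<close> certifies all inner announcements of
  \<open>u\<close>. For another suffix only the last announcement of \<open>u\<close> and the suffix
  itself remain to be checked.\<close>

lemma append_eq_annotate_iff: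
  assumes A: "is_wfa A" and "u \<noteq> []" and u: "u @ W0 = annotate A (map pfst (u @ W0))"
  shows "u @ W = annotate A (map pfst (u @ W)) \<longleftrightarrow>
    W = annotate A (map pfst W) \<and>
    accepting_states A (map pfst W) = set_decode (psnd (last u))"
proof -
  let ?v = "map pfst u"
  have split: "annotate A (map pfst (u @ X)) =
      take (length ?v) (annotate A (?v @ map pfst X)) @ annotate A (map pfst X)" for X
    using append_take_drop_id[of "length ?v" "annotate A (?v @ map pfst X)"]
    by (simp only: drop_annotate_append map_append)
  have eq: "u @ X = annotate A (map pfst (u @ X)) \<longleftrightarrow>
      u = take (length ?v) (annotate A (?v @ map pfst X)) \<and> X = annotate A (map pfst X)" for X
    unfolding split by (rule append_eq_append_conv) simp
  have last: "accepting_states A (map pfst X) = set_decode (psnd (last u))"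
    if "u = take (length ?v) (annotate A (?v @ map pfst X))" for X
  proof -
    have "psnd (last u) = set_encode (accepting_states A (map pfst X))"
      using last_take_annotate_append[of ?v A "map pfst X"] that \<open>u \<noteq> []\<close> by simp
    then show ?thesis using finite_accepting_states[OF A] by simp
  qed
  have u0: "u = take (length ?v) (annotate A (?v @ map pfst W0))" using u unfolding eq by blast
  show ?thesis
    unfolding eq using last[of W] last[OF u0] u0
      take_annotate_append_cong[of A "map pfst W" "map pfst W0" ?v]
    by auto
qed

lemma determinisable_lookahead_wfa_if_unambiguisable:
  assumes A: "is_wfa A" and "unambiguisable A"
  shows "determinisable (lookahead_wfa A)"
proof -
  let ?B = "lookahead_wfa A"
  let ?g = "wfa_value ?B" and ?L = "lists (alphabet ?B)" and ?N = "set_encode (states A)"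
  obtain U :: "(nat, nat) wfa" where U: "is_wfa U" "unambiguous U" "equivalent A U"
    using assms(2) by (auto simp: unambiguisable_def)
  let ?M = "lists (alphabet A)"
  from choice[OF allI[OF finite_residuals_fixed_lookahead[OF A U]]]
  obtain \<kappa> :: "nat set \<Rightarrow> nat list \<Rightarrow> (nat \<times> int) set" where
    "\<forall>S. finite (\<kappa> S ` ?M) \<and> (\<forall>v\<in>?M. \<forall>v'\<in>?M. \<kappa> S v = \<kappa> S v' \<longrightarrow>
       (\<exists>c. \<forall>w\<in>?M. accepting_states A w = S \<longrightarrow>
         (\<forall>k. wfa_value A (v @ w) = Fin k \<longleftrightarrow> wfa_value A (v' @ w) = Fin (k + c))))"
    by (rule exE)
  then have fin: "finite (\<kappa> S ` ?M)" and
    \<kappa>: "v \<in> ?M \<Longrightarrow> v' \<in> ?M \<Longrightarrow> \<kappa> S v = \<kappa> S v' \<Longrightarrow>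
       \<exists>c. \<forall>w\<in>?M. accepting_states A w = S \<longrightarrow>
         (\<forall>k. wfa_value A (v @ w) = Fin k \<longleftrightarrow> wfa_value A (v' @ w) = Fin (k + c))" for S v v'
    by simp_all
  have proj: "map pfst W \<in> ?M" if "W \<in> ?L" for W
    using that by (induction W) (auto simp: lookahead_wfa_sel)
  define alive where "alive u \<longleftrightarrow> (\<exists>W. u @ W = annotate A (map pfst (u @ W)))" for u
  \<comment> \<open>The Boolean separates the empty prefix, which has made no announcement, from all
    others; \<open>0\<close> against \<open>Suc\<close> separates dead prefixes from live nonempty
    ones.\<close>
  define \<mu> where "\<mu> u = (if u = [] \<or> \<not> alive u then (u = [], 0, {})
    else (False, Suc (psnd (last u)), \<kappa> (set_decode (psnd (last u))) (map pfst u)))" for u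
  have "\<mu> ` ?L \<subseteq> UNIV \<times> {..Suc ?N} \<times> insert {} (\<Union>n\<le>?N. \<kappa> (set_decode n) ` ?M)"
    (is "_ \<subseteq> ?R")
  proof (rule image_subsetI)
    fix u assume u: "u \<in> ?L"
    show "\<mu> u \<in> ?R"
    proof (cases "u = [] \<or> \<not> alive u")
      case False
      then have "last u \<in> alphabet ?B" using u last_in_set[of u] by (auto simp: in_lists_conv_set)
      then have "psnd (last u) \<le> ?N" by (simp add: lookahead_wfa_sel)
      then show ?thesis using False proj[OF u] by (auto simp: \<mu>_def)
    qed (auto simp: \<mu>_def)
  qed
  then have "finite (\<mu> ` ?L)" by (rule finite_subset) (use fin in auto)
  moreover have "\<exists>c. \<forall>W\<in>?L. \<forall>k. ?g (u @ W) = Fin k \<longleftrightarrow> ?g (u' @ W) = Fin (k + c)"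
    if u: "u \<in> ?L" "u' \<in> ?L" "\<mu> u = \<mu> u'" for u u'
  proof -
    consider "u = []" "u' = []" | "\<not> alive u" "\<not> alive u'"
      | "u \<noteq> []" "u' \<noteq> []" "alive u" "alive u'"
      using u(3) by (auto simp: \<mu>_def split: if_splits)
    then show ?thesis
    proof cases
      case 1
      then show ?thesis by (intro exI[of _ 0]) simp
    next
      case 2
      then show ?thesis by (simp add: alive_def wfa_value_lookahead_wfa[OF A])
    next
      case 3
      have "(False, Suc (psnd (last u)), \<kappa> (set_decode (psnd (last u))) (map pfst u)) =
          (False, Suc (psnd (last u')), \<kappa> (set_decode (psnd (last u'))) (map pfst u'))"
        using u(3) 3 unfolding \<mu>_def by (simp only: simp_thms if_False)
      then have last: "psnd (last u) = psnd (last u')"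
          and "\<kappa> (set_decode (psnd (last u))) (map pfst u) =
            \<kappa> (set_decode (psnd (last u'))) (map pfst u')"
        unfolding prod.inject nat.inject by blast+
      then have \<kappa>_eq: "\<kappa> (set_decode (psnd (last u))) (map pfst u) =
          \<kappa> (set_decode (psnd (last u))) (map pfst u')"
        by (simp only:)
      obtain c where c: "\<And>w k. w \<in> ?M \<Longrightarrow>
          accepting_states A w = set_decode (psnd (last u)) \<Longrightarrow>
          wfa_value A (map pfst u @ w) = Fin k \<longleftrightarrow> wfa_value A (map pfst u' @ w) = Fin (k + c)"
        using \<kappa>[OF proj[OF u(1)] proj[OF u(2)] \<kappa>_eq] by blast
      have "?g (u @ W) = Fin k \<longleftrightarrow> ?g (u' @ W) = Fin (k + c)" if W: "W \<in> ?L" for W k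
      proof -
        obtain W0 W0' where "u @ W0 = annotate A (map pfst (u @ W0))"
            "u' @ W0' = annotate A (map pfst (u' @ W0'))"
          using 3 by (auto simp: alive_def)
        \<comment> \<open>The two prefixes share their last announcement, so they admit the same
          suffixes, all with the set \<open>S\<close> for which \<open>\<kappa>\<close> was
          chosen.\<close>
        note iff = append_eq_annotate_iff[OF A 3(1) this(1), of W]
          append_eq_annotate_iff[OF A 3(2) this(2), of W]
        show ?thesis
          unfolding wfa_value_lookahead_wfa[OF A] iff last[symmetric]
          using c[OF proj[OF W]] by simp
      qed
      then show ?thesis by blast
    qed
  qed
  moreover have "?g [] \<in> {Fin 0, Infty}" by (simp add: wfa_value_eq accepted_weights_Nil)
  moreover have "finite (alphabet ?B)" using is_wfa_lookahead_wfa[OF A] by (simp add: is_wfa_def)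
  ultimately have "\<exists>D :: (nat, nat) wfa. is_wfa D \<and> deterministic D \<and> alphabet D = alphabet ?B \<and>
    (\<forall>w\<in>?L. wfa_value D w = ?g w)"
    by (intro deterministic_wfa_if_finite_residuals[of _ ?g \<mu>]) blast+
  then show ?thesis unfolding determinisable_def equivalent_def by metis
qed

theorem theorem8:
  "\<exists>f :: (nat, nat) wfa \<Rightarrow> (nat, nat) wfa.
     wfa_computable f \<and>
     (\<forall>A. is_wfa A \<longrightarrow> is_wfa (f A) \<and> (unambiguisable A \<longleftrightarrow> determinisable (f A)))"
  using wfa_computable_lookahead_wfa is_wfa_lookahead_wfa
    unambiguisable_if_determinisable_lookahead_wfa determinisable_lookahead_wfa_if_unambiguisable
  by blast

end
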